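(* Let $F_2$ be the free group of rank $2$, $\varphi\in\mathrm{Aut}(F_2)$, $G=F_2\rtimes_\varphi\mathbb{Z}$, and let $[\overline{\varphi}]\in\mathrm{GL}_2(\mathbb{Z})$ be the matrix of the automorphism of $F_2^{ab}$ induced by $\varphi$. In all cases except $\det[\overline{\varphi}]=-1$, $\mathrm{tr}[\overline{\varphi}]=\pm1$, the group $G$ contains a residually nilpotent subgroup of index $2$ that is isomorphic to $F_2\rtimes_{\varphi^2}\mathbb{Z}$. In the cases $\det[\overline{\varphi}]=-1$, $\mathrm{tr}[\overline{\varphi}]=\pm1$, the group $G$ contains a residually nilpotent subgroup of index $4$ that is isomorphic to $F_2\rtimes_{\varphi^4}\mathbb{Z}$.
   Context: $F_2^{ab}=F_2/[F_2,F_2]\cong\mathbb{Z}^2$. For $\psi\in\mathrm{Aut}(F_2)$, $F_2\rtimes_\psi\mathbb{Z}=\langle x,y,t\mid t^{-1}xt=\psi(x),\ t^{-1}yt=\psi(y)\rangle$, where $F_2=\langle x,y\rangle$. A group $G$ is residually nilpotent if every non-identity element has non-trivial image in some nilpotent quotient of $G$; equivalently $\bigcap_{k\ge1}\gamma_k(G)=1$. *)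

theory Defs
  imports
    "HOL-Analysis.Determinants"
    "HOL-Library.Numeral_Type"
    "HOL-Algebra.Bij"
    "HOL-Algebra.Generated_Groups"
    "HOL-Algebra.Elementary_Groups"
begin

section \<open>Nilpotent and residually nilpotent groups\<close>

text \<open>
  The index is shifted by one: \<open>lower_central G n\<close> is the term usually written
  \<open>\<gamma>\<close> with subscript \<open>n + 1\<close>.
\<close>

primrec lower_central :: "('a, 'b) monoid_scheme \<Rightarrow> nat \<Rightarrow> 'a set" where
  "lower_central G 0 = carrier G"
| "lower_central G (Suc n) = generate G
     {a \<otimes>\<^bsub>G\<^esub> b \<otimes>\<^bsub>G\<^esub> inv\<^bsub>G\<^esub> a \<otimes>\<^bsub>G\<^esub> inv\<^bsub>G\<^esub> b | a b. a \<in> lower_central G n \<and> b \<in> carrier G}"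

definition nilpotent_group :: "('a, 'b) monoid_scheme \<Rightarrow> bool" where
  "nilpotent_group G \<longleftrightarrow> group G \<and> (\<exists>n. lower_central G n = {\<one>\<^bsub>G\<^esub>})"

definition residually_nilpotent :: "('a, 'b) monoid_scheme \<Rightarrow> bool" where
  "residually_nilpotent G \<longleftrightarrow> group G \<and>
     (\<forall>g \<in> carrier G. g \<noteq> \<one>\<^bsub>G\<^esub> \<longrightarrow>
       (\<exists>N. N \<lhd> G \<and> nilpotent_group (G Mod N) \<and> N #>\<^bsub>G\<^esub> g \<noteq> \<one>\<^bsub>G Mod N\<^esub>))"


section \<open>Free groups\<close>

text \<open>
  The free group on the type \<open>'a\<close> consists of the reduced words in the letters
  \<open>(a, True)\<close>, which stands for \<open>a\<close>, and \<open>(a, False)\<close>, which stands for the inverse of \<open>a\<close>.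
\<close>

definition inv_letter :: "'a \<times> bool \<Rightarrow> 'a \<times> bool" where
  "inv_letter l = (fst l, \<not> snd l)"

definition reduced :: "('a \<times> bool) list \<Rightarrow> bool" where
  "reduced = successively (\<lambda>k l. l \<noteq> inv_letter k)"

definition cons_red :: "'a \<times> bool \<Rightarrow> ('a \<times> bool) list \<Rightarrow> ('a \<times> bool) list" where
  "cons_red l w = (if w \<noteq> [] \<and> hd w = inv_letter l then tl w else l # w)"

definition free_group :: "('a \<times> bool) list monoid" where
  "free_group = \<lparr>carrier = {w. reduced w}, mult = foldr cons_red, one = []\<rparr>"

definition free_gen :: "'a \<Rightarrow> ('a \<times> bool) list" where
  "free_gen a = [(a, True)]"

lemma inv_letter_inv_letter [simp]: "inv_letter (inv_letter l) = l"
  by (simp add: inv_letter_def)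

lemma inv_letter_neq [simp]: "inv_letter l \<noteq> l" "l \<noteq> inv_letter l"
  by (simp_all add: inv_letter_def prod_eq_iff)

lemma reduced_Nil [simp]: "reduced []"
  by (simp add: reduced_def)

lemma reduced_Cons: "reduced (l # w) \<longleftrightarrow> reduced w \<and> (w \<noteq> [] \<longrightarrow> hd w \<noteq> inv_letter l)"
  by (auto simp: reduced_def successively_Cons)

lemma reduced_cons_red: "reduced w \<Longrightarrow> reduced (cons_red l w)"
  by (cases w) (auto simp: cons_red_def reduced_Cons)

lemma reduced_foldr_cons_red: "reduced w \<Longrightarrow> reduced (foldr cons_red u w)"
  by (induction u) (auto simp: reduced_cons_red)

lemma cons_red_cancel: "reduced w \<Longrightarrow> cons_red l (cons_red (inv_letter l) w) = w"
  by (cases w; cases "tl w") (auto simp: cons_red_def reduced_Cons)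

lemma cons_red_cancel': "reduced w \<Longrightarrow> cons_red (inv_letter l) (cons_red l w) = w"
  using cons_red_cancel[of w "inv_letter l"] by simp

lemma foldr_cons_red_Nil: "reduced u \<Longrightarrow> foldr cons_red u [] = u"
  by (induction u) (auto simp: reduced_Cons cons_red_def)

lemma foldr_cons_red_cons_red:
  assumes "reduced w"
  shows "foldr cons_red (cons_red l v) w = cons_red l (foldr cons_red v w)"
proof (cases "v \<noteq> [] \<and> hd v = inv_letter l")
  case True
  then obtain v' where v: "v = inv_letter l # v'"
    by (cases v) auto
  then have "cons_red l v = v'" by (simp add: cons_red_def)
  then show ?thesis
    using assms by (simp add: v cons_red_cancel reduced_foldr_cons_red)
next
  case False
  then have "cons_red l v = l # v" by (auto simp: cons_red_def)
  then show ?thesis by simp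
qed

lemma foldr_cons_red_assoc:
  assumes "reduced w"
  shows "foldr cons_red (foldr cons_red u v) w = foldr cons_red u (foldr cons_red v w)"
  by (induction u) (auto simp: foldr_cons_red_cons_red assms)

lemma foldr_cons_red_inverse: "foldr cons_red (map inv_letter (rev u)) u = []"
proof (induction u)
  case (Cons l u)
  then show ?case
    by (cases u) (auto simp: cons_red_def)
qed simp

lemma reduced_inverse: "reduced u \<Longrightarrow> reduced (map inv_letter (rev u))"
proof (induction u)
  case (Cons l u)
  then show ?case
    by (cases u) (auto simp: reduced_def successively_append_iff)
qed simp

lemma group_free_group: "group free_group"
proof (rule groupI)
  fix x :: "('a \<times> bool) list" assume x: "x \<in> carrier free_group"
  show "\<exists>y\<in>carrier free_group. y \<otimes>\<^bsub>free_group\<^esub> x = \<one>\<^bsub>free_group\<^esub>"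
    using x foldr_cons_red_inverse reduced_inverse by (fastforce simp: free_group_def)
qed (auto simp: free_group_def reduced_foldr_cons_red foldr_cons_red_assoc)

lemma free_gen_closed [simp]: "free_gen a \<in> carrier free_group"
  by (simp add: free_gen_def free_group_def reduced_Cons)

lemma inv_free_gen: "inv\<^bsub>free_group\<^esub> free_gen a = [(a, False)]"
  by (rule group.inv_equality[OF group_free_group])
     (auto simp: free_gen_def free_group_def reduced_Cons cons_red_def inv_letter_def)

lemma generate_free_gen: "generate free_group (range free_gen) = carrier free_group"
proof
  interpret group "free_group :: ('a \<times> bool) list monoid" by (rule group_free_group)
  show "generate free_group (range free_gen) \<subseteq> carrier (free_group :: ('a \<times> bool) list monoid)"
    by (rule generate_incl) auto
  show "carrier free_group \<subseteq> generate free_group (range (free_gen :: 'a \<Rightarrow> _))"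
  proof
    fix w :: "('a \<times> bool) list" assume "w \<in> carrier free_group"
    then have "reduced w" by (simp add: free_group_def)
    then show "w \<in> generate free_group (range free_gen)"
    proof (induction w)
      case Nil
      then show ?case using generate.one[of "free_group :: ('a \<times> bool) list monoid"]
        by (simp add: free_group_def)
    next
      case (Cons l w)
      obtain a b where l: "l = (a, b)" by fastforce
      have "[l] \<in> generate free_group (range free_gen)"
      proof (cases b)
        case True
        then show ?thesis using generate.incl[of "free_gen a" "range free_gen"]
          by (auto simp: l free_gen_def)
      next
        case False
        then show ?thesis using generate.inv[of "free_gen a" "range free_gen" free_group]
          by (auto simp: l inv_free_gen)
      qed
      moreover have "l # w = [l] \<otimes>\<^bsub>free_group\<^esub> w"
        using Cons.prems by (auto simp: free_group_def cons_red_def reduced_Cons)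
      moreover have "w \<in> generate free_group (range free_gen)"
        using Cons by (simp add: reduced_Cons)
      ultimately show ?case by (metis generate.eng)
    qed
  qed
qed

definition free_lift :: "('g, 'c) monoid_scheme \<Rightarrow> ('a \<Rightarrow> 'g) \<Rightarrow> ('a \<times> bool) list \<Rightarrow> 'g" where
  "free_lift H f w =
     foldr (\<lambda>l h. (if snd l then f (fst l) else inv\<^bsub>H\<^esub> f (fst l)) \<otimes>\<^bsub>H\<^esub> h) w \<one>\<^bsub>H\<^esub>"

lemma free_lift_hom:
  assumes "group H" and f: "\<And>a. f a \<in> carrier H"
  shows "free_lift H f \<in> hom free_group H" and "free_lift H f (free_gen a) = f a"
proof -
  interpret group H by fact
  have cl: "free_lift H f w \<in> carrier H" for w
    by (induction w) (auto simp: free_lift_def f)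
  have lift_Cons: "free_lift H f (l # w)
      = (if snd l then f (fst l) else inv\<^bsub>H\<^esub> f (fst l)) \<otimes>\<^bsub>H\<^esub> free_lift H f w" for l w
    by (simp add: free_lift_def)
  have cons_red: "free_lift H f (cons_red l w) = free_lift H f (l # w)" for l w
  proof (cases "w \<noteq> [] \<and> hd w = inv_letter l")
    case True
    then obtain v where "w = inv_letter l # v" by (cases w) auto
    then show ?thesis
      by (simp add: cons_red_def lift_Cons inv_letter_def f cl m_assoc[symmetric])
  next
    case False
    then have "cons_red l w = l # w" by (auto simp: cons_red_def)
    then show ?thesis by simp
  qed
  have "free_lift H f (foldr cons_red u v) = free_lift H f u \<otimes>\<^bsub>H\<^esub> free_lift H f v" for u v
  proof (induction u)
    case Nil
    then show ?case using cl by (simp add: free_lift_def[of _ _ "[]"])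
  next
    case (Cons l u)
    then show ?case using cl f by (simp add: cons_red lift_Cons m_assoc)
  qed
  then show "free_lift H f \<in> hom free_group H"
    using cl by (auto simp: hom_def free_group_def)
  show "free_lift H f (free_gen a) = f a"
    using f by (simp add: free_lift_def free_gen_def)
qed

abbreviation F2 :: "(2 \<times> bool) list monoid" where
  "F2 \<equiv> free_group"


section \<open>The matrix of an automorphism of the free group of rank two\<close>

definition abelianization :: "('a, 'b) monoid_scheme \<Rightarrow> 'a set monoid" where
  "abelianization G = G Mod (derived G (carrier G))"

definition ab_class :: "('a, 'b) monoid_scheme \<Rightarrow> 'a \<Rightarrow> 'a set" where
  "ab_class G g = derived G (carrier G) #>\<^bsub>G\<^esub> g"

text \<open>
  An automorphism maps the commutator subgroup onto itself, hence cosets to cosets, and the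
  induced map on the abelianization sends a coset to its image as a set; see \<open>induced_ab_class\<close>.
\<close>

definition induced_ab :: "('a, 'b) monoid_scheme \<Rightarrow> ('a \<Rightarrow> 'a) \<Rightarrow> 'a set \<Rightarrow> 'a set" where
  "induced_ab G \<phi> = (\<lambda>C \<in> carrier (abelianization G). \<phi> ` C)"

text \<open>
  Column \<open>j\<close> holds the coordinates of the image of the \<open>j\<close>-th basis element. Here \<open>1\<close> and \<open>2\<close>
  are the two elements of the index type \<open>2\<close>.
\<close>

definition is_ab_matrix :: "((2 \<times> bool) list \<Rightarrow> (2 \<times> bool) list) \<Rightarrow> int^2^2 \<Rightarrow> bool" where
  "is_ab_matrix \<phi> A \<longleftrightarrow>
     (\<forall>j. induced_ab F2 \<phi> (ab_class F2 (free_gen j)) =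
        ab_class F2 (free_gen 1) [^]\<^bsub>abelianization F2\<^esub> (A $ 1 $ j)
          \<otimes>\<^bsub>abelianization F2\<^esub>
        ab_class F2 (free_gen 2) [^]\<^bsub>abelianization F2\<^esub> (A $ 2 $ j))"

definition ab_matrix :: "((2 \<times> bool) list \<Rightarrow> (2 \<times> bool) list) \<Rightarrow> int^2^2" where
  "ab_matrix \<phi> = (THE A. is_ab_matrix \<phi> A)"

lemma ab_class_hom:
  assumes "group G"
  shows "comm_group (abelianization G)" and "ab_class G \<in> hom G (abelianization G)"
    and "ab_class G ` carrier G = carrier (abelianization G)"
proof -
  interpret group G by fact
  interpret N: normal "derived G (carrier G)" G by (rule derived_self_is_normal)
  show "comm_group (abelianization G)"
    unfolding abelianization_def by (rule derived_quot_is_comm_group)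
  show "ab_class G \<in> hom G (abelianization G)"
    unfolding abelianization_def ab_class_def[abs_def] by (rule N.r_coset_hom_Mod)
  show "ab_class G ` carrier G = carrier (abelianization G)"
    by (auto simp: ab_class_def abelianization_def FactGroup_def RCOSETS_def)
qed

lemma auto_iso: "\<phi> \<in> auto G \<Longrightarrow> \<phi> \<in> iso G G"
  by (auto simp: auto_def Bij_def iso_def)

lemma auto_image_derived:
  assumes "group G" "\<phi> \<in> auto G"
  shows "\<phi> ` derived G (carrier G) = derived G (carrier G)"
proof -
  interpret group_hom G G \<phi>
    using assms auto_iso[of \<phi> G] by (auto simp: group_hom_def group_hom_axioms_def iso_def)
  have "\<phi> ` carrier G = carrier G"
    using auto_iso[OF assms(2)] by (auto simp: iso_def bij_betw_def)
  then show ?thesis using derived_img[of "carrier G"] by simp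
qed

lemma induced_ab_class:
  assumes "group G" "\<phi> \<in> auto G" "g \<in> carrier G"
  shows "induced_ab G \<phi> (ab_class G g) = ab_class G (\<phi> g)"
proof -
  interpret group G by fact
  have hom: "\<phi> (x \<otimes>\<^bsub>G\<^esub> y) = \<phi> x \<otimes>\<^bsub>G\<^esub> \<phi> y" if "x \<in> carrier G" "y \<in> carrier G" for x y
    using assms(2) that by (auto simp: auto_def hom_def)
  have sub: "derived G (carrier G) \<subseteq> carrier G" by (rule derived_in_carrier) simp
  have "\<phi> ` ab_class G g = (\<Union>h \<in> derived G (carrier G). {\<phi> h \<otimes>\<^bsub>G\<^esub> \<phi> g})"
    unfolding ab_class_def r_coset_def image_UN
    by (rule SUP_cong) (use hom assms(3) sub in auto)
  also have "\<dots> = (\<Union>h \<in> \<phi> ` derived G (carrier G). {h \<otimes>\<^bsub>G\<^esub> \<phi> g})" by blast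
  also have "\<dots> = ab_class G (\<phi> g)"
    by (simp only: auto_image_derived[OF assms(1,2)]) (simp add: ab_class_def r_coset_def)
  finally have "\<phi> ` ab_class G g = ab_class G (\<phi> g)" .
  moreover have "ab_class G g \<in> carrier (abelianization G)"
    using ab_class_hom(3)[OF assms(1)] assms(3) by blast
  ultimately show ?thesis by (simp add: induced_ab_def)
qed

lemma F2_ab_coords:
  assumes "w \<in> carrier F2"
  shows "\<exists>(m::int) (n::int). ab_class F2 w =
    ab_class F2 (free_gen 1) [^]\<^bsub>abelianization F2\<^esub> m
      \<otimes>\<^bsub>abelianization F2\<^esub> ab_class F2 (free_gen 2) [^]\<^bsub>abelianization F2\<^esub> n"
proof -
  let ?Q = "abelianization F2"
  let ?x = "ab_class F2 (free_gen 1)" and ?y = "ab_class F2 (free_gen 2)"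
  interpret Q: comm_group ?Q by (rule ab_class_hom(1)[OF group_free_group])
  interpret h: group_hom F2 ?Q "ab_class F2"
    using ab_class_hom(2)[OF group_free_group] group_free_group Q.is_group
    by (auto simp: group_hom_def group_hom_axioms_def)
  have x: "?x \<in> carrier ?Q" and y: "?y \<in> carrier ?Q" by auto
  have gen: "\<exists>(m::int) (n::int). ab_class F2 (free_gen j) = ?x [^]\<^bsub>?Q\<^esub> m \<otimes>\<^bsub>?Q\<^esub> ?y [^]\<^bsub>?Q\<^esub> n
      \<and> inv\<^bsub>?Q\<^esub> ab_class F2 (free_gen j) = ?x [^]\<^bsub>?Q\<^esub> (-m) \<otimes>\<^bsub>?Q\<^esub> ?y [^]\<^bsub>?Q\<^esub> (-n)" for j :: 2
  proof (cases "j = 1")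
    case True
    have "?x = ?x [^]\<^bsub>?Q\<^esub> (1::int) \<otimes>\<^bsub>?Q\<^esub> ?y [^]\<^bsub>?Q\<^esub> (0::int)"
      "inv\<^bsub>?Q\<^esub> ?x = ?x [^]\<^bsub>?Q\<^esub> (-1::int) \<otimes>\<^bsub>?Q\<^esub> ?y [^]\<^bsub>?Q\<^esub> (-0::int)"
      using x y by (simp_all add: Q.int_pow_neg)
    then show ?thesis unfolding True
      by (intro exI[of _ "1::int"] exI[of _ "0::int"] conjI)
  next
    case False
    then have j: "j = 2" using exhaust_2 by blast
    have "?y = ?x [^]\<^bsub>?Q\<^esub> (0::int) \<otimes>\<^bsub>?Q\<^esub> ?y [^]\<^bsub>?Q\<^esub> (1::int)"
      "inv\<^bsub>?Q\<^esub> ?y = ?x [^]\<^bsub>?Q\<^esub> (-0::int) \<otimes>\<^bsub>?Q\<^esub> ?y [^]\<^bsub>?Q\<^esub> (-1::int)"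
      using x y by (simp_all add: Q.int_pow_neg)
    then show ?thesis unfolding j
      by (intro exI[of _ "0::int"] exI[of _ "1::int"] conjI)
  qed
  have "w \<in> generate F2 (range free_gen)" using assms generate_free_gen by blast
  then show ?thesis
  proof (induction w rule: generate.induct)
    case one
    have "ab_class F2 \<one>\<^bsub>F2\<^esub> = ?x [^]\<^bsub>?Q\<^esub> (0::int) \<otimes>\<^bsub>?Q\<^esub> ?y [^]\<^bsub>?Q\<^esub> (0::int)"
      using h.hom_one by simp
    then show ?case by blast
  next
    case (incl w)
    then show ?case using gen by blast
  next
    case (inv w)
    then obtain j where w: "w = free_gen j" by blast
    have "ab_class F2 (inv\<^bsub>F2\<^esub> w) = inv\<^bsub>?Q\<^esub> ab_class F2 (free_gen j)"
      by (simp add: w)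
    then show ?case using gen[of j] by metis
  next
    case (eng u v)
    have uv: "u \<in> carrier F2" "v \<in> carrier F2"
      using eng generate_free_gen[where 'a = 2] by auto
    from eng obtain m n m' n' :: int where
      u: "ab_class F2 u = ?x [^]\<^bsub>?Q\<^esub> m \<otimes>\<^bsub>?Q\<^esub> ?y [^]\<^bsub>?Q\<^esub> n" and
      v: "ab_class F2 v = ?x [^]\<^bsub>?Q\<^esub> m' \<otimes>\<^bsub>?Q\<^esub> ?y [^]\<^bsub>?Q\<^esub> n'" by blast
    have "ab_class F2 (u \<otimes>\<^bsub>F2\<^esub> v) = ?x [^]\<^bsub>?Q\<^esub> (m + m') \<otimes>\<^bsub>?Q\<^esub> ?y [^]\<^bsub>?Q\<^esub> (n + n')"
      using uv x y by (simp add: u v Q.int_pow_mult Q.m_ac)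
    then show ?case by blast
  qed
qed

lemma F2_ab_coords_unique:
  assumes "ab_class F2 (free_gen 1) [^]\<^bsub>abelianization F2\<^esub> (m::int)
      \<otimes>\<^bsub>abelianization F2\<^esub> ab_class F2 (free_gen 2) [^]\<^bsub>abelianization F2\<^esub> (n::int)
    = ab_class F2 (free_gen 1) [^]\<^bsub>abelianization F2\<^esub> (m'::int)
      \<otimes>\<^bsub>abelianization F2\<^esub> ab_class F2 (free_gen 2) [^]\<^bsub>abelianization F2\<^esub> (n'::int)"
  shows "m = m' \<and> n = n'"
proof -
  let ?Q = "abelianization F2"
  let ?D = "derived F2 (carrier F2)"
  interpret F: group F2 by (rule group_free_group)
  interpret Q: comm_group ?Q by (rule ab_class_hom(1)[OF group_free_group])
  interpret h: group_hom F2 ?Q "ab_class F2"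
    using ab_class_hom(2)[OF group_free_group] group_free_group Q.is_group
    by (auto simp: group_hom_def group_hom_axioms_def)
  have integer_pow: "a [^]\<^bsub>integer_group\<^esub> k = k * a" for a k :: int
    by (simp add: mult.commute)
  interpret Z: comm_group integer_group
    by (rule group.group_comm_groupI) (auto simp: ac_simps)
  let ?w = "free_gen 1 [^]\<^bsub>F2\<^esub> m \<otimes>\<^bsub>F2\<^esub> free_gen 2 [^]\<^bsub>F2\<^esub> n"
  let ?w' = "free_gen 1 [^]\<^bsub>F2\<^esub> m' \<otimes>\<^bsub>F2\<^esub> free_gen 2 [^]\<^bsub>F2\<^esub> n'"
  have "ab_class F2 ?w = ab_class F2 ?w'"
    using assms by (simp add: h.hom_int_pow)
  then have "?w \<in> ?D #>\<^bsub>F2\<^esub> ?w'"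
    using F.rcos_self[of ?w ?D] F.derived_is_subgroup[of "carrier F2"]
    by (simp add: ab_class_def)
  then obtain d where d: "d \<in> ?D" "?w = d \<otimes>\<^bsub>F2\<^esub> ?w'"
    by (auto simp: r_coset_def)
  have eq: "e ?w = e ?w'" if "e \<in> hom F2 integer_group" for e
  proof -
    interpret e: group_hom F2 integer_group e
      using that by (auto simp: group_hom_def group_hom_axioms_def)
    have "e ` ?D = derived integer_group (e ` carrier F2)"
      by (rule e.derived_img[symmetric]) simp
    also have "\<dots> = {0}" using Z.derived_eq_singleton[of "e ` carrier F2"] by auto
    finally have "e d = 0" using d(1) by blast
    moreover have "d \<in> carrier F2" using d(1) F.derived_in_carrier[of "carrier F2"] by auto
    ultimately show ?thesis using d(2) e.hom_mult[of d ?w'] by simp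
  qed
  have "m * f 1 + n * f 2 = m' * f 1 + n' * f 2" for f :: "2 \<Rightarrow> int"
  proof -
    let ?e = "free_lift integer_group f"
    have hom: "?e \<in> hom F2 integer_group" and gen: "?e (free_gen j) = f j" for j
      by (rule free_lift_hom; simp)+
    interpret e: group_hom F2 integer_group ?e
      using hom by (auto simp: group_hom_def group_hom_axioms_def)
    have "?e ?w = m * f 1 + n * f 2" "?e ?w' = m' * f 1 + n' * f 2"
      by (simp_all add: e.hom_int_pow gen integer_pow)
    then show ?thesis using eq[OF hom] by simp
  qed
  from this[of "\<lambda>j. if j = 1 then 1 else 0"] this[of "\<lambda>j. if j = 2 then 1 else 0"]
  show ?thesis by simp
qed

lemma is_ab_matrix_ex1:
  assumes "\<phi> \<in> auto F2"
  shows "\<exists>!A. is_ab_matrix \<phi> A"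
proof -
  let ?Q = "abelianization F2"
  have cl: "\<phi> (free_gen j) \<in> carrier F2" for j
    using assms by (auto simp: auto_def hom_def)
  have "\<forall>j. \<exists>(m::int) (n::int). ab_class F2 (\<phi> (free_gen j)) =
     ab_class F2 (free_gen 1) [^]\<^bsub>?Q\<^esub> m \<otimes>\<^bsub>?Q\<^esub> ab_class F2 (free_gen 2) [^]\<^bsub>?Q\<^esub> n"
    using F2_ab_coords[OF cl] by blast
  then obtain m n :: "2 \<Rightarrow> int" where mn: "\<And>j. ab_class F2 (\<phi> (free_gen j)) =
     ab_class F2 (free_gen 1) [^]\<^bsub>?Q\<^esub> m j \<otimes>\<^bsub>?Q\<^esub> ab_class F2 (free_gen 2) [^]\<^bsub>?Q\<^esub> n j"
    by metis
  have ind: "induced_ab F2 \<phi> (ab_class F2 (free_gen j)) = ab_class F2 (\<phi> (free_gen j))" for j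
    by (rule induced_ab_class[OF group_free_group assms]) simp
  show ?thesis
  proof (rule ex1I)
    show "is_ab_matrix \<phi> (\<chi> i j. if i = 1 then m j else n j)"
      by (simp add: is_ab_matrix_def ind mn)
  next
    fix A assume "is_ab_matrix \<phi> A"
    then have "A $ 1 $ j = m j \<and> A $ 2 $ j = n j" for j
      using F2_ab_coords_unique unfolding is_ab_matrix_def ind mn by metis
    then show "A = (\<chi> i j. if i = 1 then m j else n j)"
      by (simp add: vec_eq_iff forall_2)
  qed
qed

lemma is_ab_matrix_ab_matrix: "\<phi> \<in> auto F2 \<Longrightarrow> is_ab_matrix \<phi> (ab_matrix \<phi>)"
  unfolding ab_matrix_def by (rule theI') (rule is_ab_matrix_ex1)


section \<open>Semidirect products with the integers\<close>

text \<open>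
  The pair \<open>(k, u)\<close> stands for the element \<open>t ^ k u\<close>, where conjugation by the stable letter \<open>t\<close>
  is the relation \<open>t\<^sup>-\<^sup>1 u t = \<phi> u\<close>, and so \<open>(t ^ k u) (t ^ l v) = t ^ (k + l) (\<phi> ^ l u) v\<close>.
  Powers of \<open>\<phi>\<close> with integer exponents are taken in the automorphism group.
\<close>

definition semidirect_int :: "('a, 'b) monoid_scheme \<Rightarrow> ('a \<Rightarrow> 'a) \<Rightarrow> (int \<times> 'a) monoid" where
  "semidirect_int G \<phi> =
     \<lparr>carrier = UNIV \<times> carrier G,
      mult = (\<lambda>(k, u) (l, v). (k + l, (\<phi> [^]\<^bsub>AutoGroup G\<^esub> l) u \<otimes>\<^bsub>G\<^esub> v)),
      one = (0, \<one>\<^bsub>G\<^esub>)\<rparr>"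

lemma carrier_AutoGroup: "carrier (AutoGroup G) = auto G"
  by (simp add: AutoGroup_def)

lemma AutoGroup_mult_apply:
  "f \<in> auto G \<Longrightarrow> g \<in> auto G \<Longrightarrow> u \<in> carrier G \<Longrightarrow> (f \<otimes>\<^bsub>AutoGroup G\<^esub> g) u = f (g u)"
  by (simp add: AutoGroup_def BijGroup_def auto_def compose_def)

lemma AutoGroup_one_apply: "u \<in> carrier G \<Longrightarrow> \<one>\<^bsub>AutoGroup G\<^esub> u = u"
  by (simp add: AutoGroup_def BijGroup_def)

lemma group_semidirect_int:
  assumes "group G" "\<phi> \<in> auto G"
  shows "group (semidirect_int G \<phi>)"
proof -
  interpret G: group G by fact
  interpret A: group "AutoGroup G" by (rule G.AutoGroup)
  define p where "p = (\<lambda>l::int. \<phi> [^]\<^bsub>AutoGroup G\<^esub> l)"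
  have phi: "\<phi> \<in> carrier (AutoGroup G)" using assms by (simp add: carrier_AutoGroup)
  have p: "p l \<in> auto G" for l
    using A.int_pow_closed[OF phi] by (simp add: p_def carrier_AutoGroup)
  have cl: "p l u \<in> carrier G" if "u \<in> carrier G" for l u
    using p[of l] that by (auto simp: auto_def hom_def)
  have hom: "p l (u \<otimes>\<^bsub>G\<^esub> v) = p l u \<otimes>\<^bsub>G\<^esub> p l v" if "u \<in> carrier G" "v \<in> carrier G" for l u v
    using p[of l] that by (auto simp: auto_def hom_def)
  have add: "p (k + l) u = p k (p l u)" if "u \<in> carrier G" for k l u
    using AutoGroup_mult_apply[OF p p that, of k l] A.int_pow_mult[OF phi, of k l]
    by (simp add: p_def)
  have one: "p l \<one>\<^bsub>G\<^esub> = \<one>\<^bsub>G\<^esub>" for l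
    using p[of l] G.is_group by (auto simp: auto_def intro: hom_one)
  have zero: "p 0 u = u" if "u \<in> carrier G" for u
    using AutoGroup_one_apply[OF that] by (simp add: p_def)
  show ?thesis
  proof (rule groupI)
    fix x assume "x \<in> carrier (semidirect_int G \<phi>)"
    then obtain k u where x: "x = (k, u)" "u \<in> carrier G" by (auto simp: semidirect_int_def)
    let ?y = "(-k, p (-k) (inv\<^bsub>G\<^esub> u))"
    have "p k (p (-k) (inv\<^bsub>G\<^esub> u)) = inv\<^bsub>G\<^esub> u"
      using x add[of "inv\<^bsub>G\<^esub> u" k "-k"] zero by simp
    then have "?y \<otimes>\<^bsub>semidirect_int G \<phi>\<^esub> x = \<one>\<^bsub>semidirect_int G \<phi>\<^esub>"
      using x by (simp add: semidirect_int_def p_def[symmetric])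
    moreover have "?y \<in> carrier (semidirect_int G \<phi>)"
      using x cl by (simp add: semidirect_int_def)
    ultimately show "\<exists>y\<in>carrier (semidirect_int G \<phi>).
        y \<otimes>\<^bsub>semidirect_int G \<phi>\<^esub> x = \<one>\<^bsub>semidirect_int G \<phi>\<^esub>" by blast
  next
    fix x y z
    assume "x \<in> carrier (semidirect_int G \<phi>)" "y \<in> carrier (semidirect_int G \<phi>)"
      "z \<in> carrier (semidirect_int G \<phi>)"
    then obtain j u k v l w where xyz: "x = (j, u)" "y = (k, v)" "z = (l, w)"
      and uvw: "u \<in> carrier G" "v \<in> carrier G" "w \<in> carrier G"
      by (auto simp: semidirect_int_def)
    have "p (k + l) u = p l (p k u)" using add[OF uvw(1), of l k] by (simp add: add.commute)
    then show "x \<otimes>\<^bsub>semidirect_int G \<phi>\<^esub> y \<otimes>\<^bsub>semidirect_int G \<phi>\<^esub> z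
        = x \<otimes>\<^bsub>semidirect_int G \<phi>\<^esub> (y \<otimes>\<^bsub>semidirect_int G \<phi>\<^esub> z)"
      using uvw by (simp add: xyz semidirect_int_def p_def[symmetric] hom cl G.m_assoc)
  next
    fix x y
    assume "x \<in> carrier (semidirect_int G \<phi>)" "y \<in> carrier (semidirect_int G \<phi>)"
    then show "x \<otimes>\<^bsub>semidirect_int G \<phi>\<^esub> y \<in> carrier (semidirect_int G \<phi>)"
      by (auto simp: semidirect_int_def p_def[symmetric] cl)
  next
    fix x
    assume "x \<in> carrier (semidirect_int G \<phi>)"
    then show "\<one>\<^bsub>semidirect_int G \<phi>\<^esub> \<otimes>\<^bsub>semidirect_int G \<phi>\<^esub> x = x"
      by (auto simp: semidirect_int_def p_def[symmetric] one)
  qed (simp add: semidirect_int_def)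
qed

lemma semidirect_int_relation:
  assumes "group G" "\<phi> \<in> auto G" "u \<in> carrier G"
  shows "inv\<^bsub>semidirect_int G \<phi>\<^esub> (1, \<one>\<^bsub>G\<^esub>) \<otimes>\<^bsub>semidirect_int G \<phi>\<^esub> (0, u)
           \<otimes>\<^bsub>semidirect_int G \<phi>\<^esub> (1, \<one>\<^bsub>G\<^esub>) = (0, \<phi> u)"
proof -
  let ?S = "semidirect_int G \<phi>"
  interpret G: group G by fact
  interpret A: group "AutoGroup G" by (rule G.AutoGroup)
  interpret S: group ?S by (rule group_semidirect_int) fact+
  have phi: "\<phi> \<in> carrier (AutoGroup G)" using assms by (simp add: carrier_AutoGroup)
  have cl: "\<phi> u \<in> carrier G" using assms by (auto simp: auto_def hom_def)
  have "(1, \<one>\<^bsub>G\<^esub>) \<otimes>\<^bsub>?S\<^esub> (0, \<phi> u) = (0, u) \<otimes>\<^bsub>?S\<^esub> (1, \<one>\<^bsub>G\<^esub>)"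
    using phi cl by (simp add: semidirect_int_def AutoGroup_one_apply)
  moreover have "(1, \<one>\<^bsub>G\<^esub>) \<in> carrier ?S" "(0, u) \<in> carrier ?S" "(0, \<phi> u) \<in> carrier ?S"
    using assms cl by (auto simp: semidirect_int_def)
  ultimately show ?thesis by (simp add: S.m_assoc S.inv_solve_left')
qed

text \<open>
  Universal property of the presentation obtained from \<open>G\<close> by adjoining a generator \<open>t\<close> with
  the relations \<open>t\<^sup>-\<^sup>1 u t = \<phi> u\<close>.
\<close>

lemma semidirect_int_lift:
  assumes "group G" "\<phi> \<in> auto G" "group H" "f \<in> hom G H" "s \<in> carrier H"
    and rel: "\<And>u. u \<in> carrier G \<Longrightarrow> inv\<^bsub>H\<^esub> s \<otimes>\<^bsub>H\<^esub> f u \<otimes>\<^bsub>H\<^esub> s = f (\<phi> u)"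
  shows "\<exists>g \<in> hom (semidirect_int G \<phi>) H. (\<forall>u \<in> carrier G. g (0, u) = f u) \<and> g (1, \<one>\<^bsub>G\<^esub>) = s"
proof -
  interpret G: group G by fact
  interpret H: group H by fact
  interpret f: group_hom G H f
    using assms by (simp add: group_hom_def group_hom_axioms_def)
  interpret A: group "AutoGroup G" by (rule G.AutoGroup)
  have phi: "\<phi> \<in> carrier (AutoGroup G)" using assms by (simp add: carrier_AutoGroup)
  have phi_cl: "\<phi> u \<in> carrier G" if "u \<in> carrier G" for u
    using assms that by (auto simp: auto_def hom_def)
  define p where "p = (\<lambda>l::int. \<phi> [^]\<^bsub>AutoGroup G\<^esub> l)"
  have p: "p l \<in> auto G" for l
    using A.int_pow_closed[OF phi] by (simp add: p_def carrier_AutoGroup)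
  have cl: "p l u \<in> carrier G" if "u \<in> carrier G" for l u
    using p[of l] that by (auto simp: auto_def hom_def)
  have add: "p (k + l) u = p k (p l u)" if "u \<in> carrier G" for k l u
    using AutoGroup_mult_apply[OF p p that, of k l] A.int_pow_mult[OF phi, of k l]
    by (simp add: p_def)
  have zero: "p 0 u = u" if "u \<in> carrier G" for u
    using AutoGroup_one_apply[OF that] by (simp add: p_def)
  have one: "p 1 = \<phi>" using phi by (simp add: p_def)
  define S where "S = (\<lambda>l::int. s [^]\<^bsub>H\<^esub> l)"
  have S_cl: "S l \<in> carrier H" for l using assms(5) by (simp add: S_def)
  have S_add: "S (k + l) = S k \<otimes>\<^bsub>H\<^esub> S l" for k l
    using assms(5) by (simp add: S_def H.int_pow_mult)
  have S0: "S 0 = \<one>\<^bsub>H\<^esub>" and S1: "S 1 = s" using assms(5) by (simp_all add: S_def)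
  have rel': "f u \<otimes>\<^bsub>H\<^esub> s = s \<otimes>\<^bsub>H\<^esub> f (\<phi> u)" if "u \<in> carrier G" for u
    using assms(5) that by (simp add: rel[OF that, symmetric] H.m_assoc[symmetric])
  have nat: "f u \<otimes>\<^bsub>H\<^esub> S (int n) = S (int n) \<otimes>\<^bsub>H\<^esub> f (p (int n) u)" if "u \<in> carrier G" for n u
    using that
  proof (induction n arbitrary: u)
    case 0
    then show ?case by (simp add: S0 zero)
  next
    case (Suc n)
    have S_Suc: "S (int (Suc n)) = s \<otimes>\<^bsub>H\<^esub> S (int n)" using S_add[of 1 "int n"] by (simp add: S1)
    have p_Suc: "p (int (Suc n)) u = p (int n) (\<phi> u)"
      using add[OF Suc.prems, of "int n" 1] by (simp add: one add.commute)
    have "f u \<otimes>\<^bsub>H\<^esub> S (int (Suc n)) = s \<otimes>\<^bsub>H\<^esub> (f (\<phi> u) \<otimes>\<^bsub>H\<^esub> S (int n))"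
      using Suc.prems assms(5) S_cl phi_cl
      by (simp add: S_Suc H.m_assoc[symmetric] rel' del: of_nat_Suc)
    also have "\<dots> = S (int (Suc n)) \<otimes>\<^bsub>H\<^esub> f (p (int (Suc n)) u)"
      unfolding Suc.IH[OF phi_cl[OF Suc.prems]] S_Suc p_Suc
      using Suc.prems assms(5) S_cl phi_cl cl by (simp add: H.m_assoc)
    finally show ?case .
  qed
  have conj: "f u \<otimes>\<^bsub>H\<^esub> S l = S l \<otimes>\<^bsub>H\<^esub> f (p l u)" if u: "u \<in> carrier G" for l u
  proof (cases "l \<ge> 0")
    case True
    then show ?thesis using nat[OF u, of "nat l"] by simp
  next
    case False
    define n where "n = nat (-l)"
    have l: "l = - int n" using False by (simp add: n_def)
    let ?v = "p l u"
    have v: "?v \<in> carrier G" by (rule cl[OF u])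
    have "p (int n) ?v = u" using add[OF u, of "int n" l] by (simp add: l zero u)
    then have "f ?v \<otimes>\<^bsub>H\<^esub> S (int n) = S (int n) \<otimes>\<^bsub>H\<^esub> f u" using nat[OF v, of n] by simp
    then have "S l \<otimes>\<^bsub>H\<^esub> (f ?v \<otimes>\<^bsub>H\<^esub> S (int n)) \<otimes>\<^bsub>H\<^esub> S l = S l \<otimes>\<^bsub>H\<^esub> (S (int n) \<otimes>\<^bsub>H\<^esub> f u) \<otimes>\<^bsub>H\<^esub> S l"
      by simp
    moreover have "S (int n) \<otimes>\<^bsub>H\<^esub> S l = \<one>\<^bsub>H\<^esub>" "S l \<otimes>\<^bsub>H\<^esub> S (int n) = \<one>\<^bsub>H\<^esub>"
      using S_add[of "int n" l] S_add[of l "int n"] by (simp_all add: l S0)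
    ultimately have "S l \<otimes>\<^bsub>H\<^esub> f ?v = f u \<otimes>\<^bsub>H\<^esub> S l"
      using u v S_cl f.hom_closed H.m_assoc H.m_closed H.l_one H.r_one by metis
    then show ?thesis by simp
  qed
  let ?g = "\<lambda>(k, u). S k \<otimes>\<^bsub>H\<^esub> f u"
  have "?g \<in> hom (semidirect_int G \<phi>) H"
  proof (rule homI)
    fix x assume "x \<in> carrier (semidirect_int G \<phi>)"
    then show "?g x \<in> carrier H" using S_cl by (auto simp: semidirect_int_def)
  next
    fix x y assume "x \<in> carrier (semidirect_int G \<phi>)" "y \<in> carrier (semidirect_int G \<phi>)"
    then obtain k u l v where xy: "x = (k, u)" "y = (l, v)"
      and uv: "u \<in> carrier G" "v \<in> carrier G" by (auto simp: semidirect_int_def)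
    have "?g x \<otimes>\<^bsub>H\<^esub> ?g y = S k \<otimes>\<^bsub>H\<^esub> (f u \<otimes>\<^bsub>H\<^esub> S l) \<otimes>\<^bsub>H\<^esub> f v"
      using uv S_cl by (simp add: xy H.m_assoc)
    also have "\<dots> = S (k + l) \<otimes>\<^bsub>H\<^esub> f (p l u \<otimes>\<^bsub>G\<^esub> v)"
      unfolding conj[OF uv(1)] using uv S_cl cl by (simp add: S_add H.m_assoc)
    also have "\<dots> = ?g (x \<otimes>\<^bsub>semidirect_int G \<phi>\<^esub> y)"
      by (simp add: xy semidirect_int_def p_def)
    finally show "?g (x \<otimes>\<^bsub>semidirect_int G \<phi>\<^esub> y) = ?g x \<otimes>\<^bsub>H\<^esub> ?g y" by simp
  qed
  moreover have "?g (0, u) = f u" if "u \<in> carrier G" for u using that by (simp add: S0)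
  moreover have "?g (1, \<one>\<^bsub>G\<^esub>) = s" using assms(5) by (simp add: S1)
  ultimately show ?thesis by blast
qed

end

theory Submission
  imports Defs "HOL-Computational_Algebra.Primes"
begin

text \<open>
  Let \<open>B\<close> be the matrix of \<open>\<psi> = \<phi>\<^sup>m\<close>, where \<open>m\<close> is \<open>2\<close> or \<open>4\<close>. Then \<open>det B = 1\<close>, and some prime
  \<open>p\<close> divides \<open>trace B - 2\<close>, so that \<open>(B - 1)\<^sup>2 = 0\<close> modulo \<open>p\<close>. The group \<open>S = F \<rtimes> \<int>\<close> defined by
  \<open>\<psi>\<close> acts on the functions from \<open>F\<close> to the integers modulo \<open>p\<close>, and the lower central series of
  \<open>S\<close> eventually fixes every function that is annihilated by all long products of factors
  \<open>g - 1\<close>. Because \<open>B - 1\<close> is nilpotent modulo \<open>p\<close>, a function belongs to this class as soon as its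
  differences in the direction of the free generators do. A class of functions that is a ring,
  invariant under translations and closed under this kind of integration separates the points
  of a free group, so no non-trivial element of \<open>F\<close> lies in every term of the lower central series.
\<close>

section \<open>Lower central series\<close>

text \<open>A surjective homomorphism maps the commutators that generate each term onto those of the
  next group, and \<open>generate\<close> commutes with images. It is applied below to conjugations,
  to quotient maps and to isomorphisms.\<close>

lemma (in group_hom) lower_central_img:
  assumes "h ` carrier G = carrier H"
  shows "lower_central H n = h ` lower_central G n"
proof (induction n)
  case 0
  then show ?case using assms by simp
next
  case (Suc n)
  let ?C = "{a \<otimes>\<^bsub>G\<^esub> b \<otimes>\<^bsub>G\<^esub> inv\<^bsub>G\<^esub> a \<otimes>\<^bsub>G\<^esub> inv\<^bsub>G\<^esub> b | a b. a \<in> lower_central G n \<and> b \<in> carrier G}"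
  have sub: "lower_central G n \<subseteq> carrier G"
  proof (induction n)
    case (Suc n)
    then show ?case by (auto intro!: G.generate_incl)
  qed simp
  have img: "h (a \<otimes>\<^bsub>G\<^esub> b \<otimes>\<^bsub>G\<^esub> inv\<^bsub>G\<^esub> a \<otimes>\<^bsub>G\<^esub> inv\<^bsub>G\<^esub> b)
      = h a \<otimes>\<^bsub>H\<^esub> h b \<otimes>\<^bsub>H\<^esub> inv\<^bsub>H\<^esub> h a \<otimes>\<^bsub>H\<^esub> inv\<^bsub>H\<^esub> h b"
    if "a \<in> lower_central G n" "b \<in> carrier G" for a b
    using that sub by auto
  have "{a \<otimes>\<^bsub>H\<^esub> b \<otimes>\<^bsub>H\<^esub> inv\<^bsub>H\<^esub> a \<otimes>\<^bsub>H\<^esub> inv\<^bsub>H\<^esub> b | a b. a \<in> lower_central H n \<and> b \<in> carrier H} =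
      {h (a \<otimes>\<^bsub>G\<^esub> b \<otimes>\<^bsub>G\<^esub> inv\<^bsub>G\<^esub> a \<otimes>\<^bsub>G\<^esub> inv\<^bsub>G\<^esub> b) | a b. a \<in> lower_central G n \<and> b \<in> carrier G}"
    unfolding Suc assms[symmetric] using img by (intro Collect_cong) (auto; metis)
  also have "\<dots> = h ` ?C" by blast
  finally have "lower_central H (Suc n) = generate H (h ` ?C)" by simp
  have "?C \<subseteq> carrier G" using sub by auto
  then have "generate H (h ` ?C) = h ` generate G ?C" by (rule generate_img)
  then show ?case using \<open>lower_central H (Suc n) = generate H (h ` ?C)\<close> by simp
qed

text \<open>Conjugation by \<open>g\<close> is a surjective endomorphism, so
  \<open>lower_central_img\<close> shows that it maps every term onto itself.\<close>

lemma (in group) lower_central_normal: "lower_central G n \<lhd> G"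
proof -
  have sub: "subgroup (lower_central G n) G"
  proof (induction n)
    case 0
    then show ?case by (simp add: subgroup_self)
  next
    case (Suc n)
    then show ?case by (auto intro!: generate_is_subgroup dest: subgroup.mem_carrier)
  qed
  have "g \<otimes> x \<otimes> inv g \<in> lower_central G n" if g: "g \<in> carrier G" and x: "x \<in> lower_central G n" for g x
  proof -
    let ?c = "\<lambda>x. g \<otimes> x \<otimes> inv g"
    interpret c: group_hom G G ?c
      using g by unfold_locales (auto simp: hom_def m_assoc inv_solve_left)
    have "y \<in> ?c ` carrier G" if "y \<in> carrier G" for y
      using g that by (intro image_eqI[of _ _ "inv g \<otimes> y \<otimes> g"]) (auto simp: m_assoc[symmetric], simp add: m_assoc)
    then have "?c ` carrier G = carrier G" using g by auto
    then have "lower_central G n = ?c ` lower_central G n" by (rule c.lower_central_img)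
    then show ?thesis using x by blast
  qed
  then show ?thesis using sub by (simp add: normal_inv_iff)
qed

text \<open>The quotient by a term that misses \<open>g\<close> serves as witness: its own term of
  the same index is the image of the subgroup divided out, hence trivial.\<close>

lemma residually_nilpotentI:
  assumes "group G"
    and "\<And>g. g \<in> carrier G \<Longrightarrow> g \<noteq> \<one>\<^bsub>G\<^esub> \<Longrightarrow> \<exists>n. g \<notin> lower_central G n"
  shows "residually_nilpotent G"
  unfolding residually_nilpotent_def
proof (intro conjI ballI impI)
  interpret group G by fact
  fix g assume g: "g \<in> carrier G" "g \<noteq> \<one>\<^bsub>G\<^esub>"
  then obtain n where n: "g \<notin> lower_central G n" using assms(2) by blast
  let ?N = "lower_central G n"
  interpret N: normal ?N G by (rule lower_central_normal)
  interpret h: group_hom G "G Mod ?N" "\<lambda>a. ?N #>\<^bsub>G\<^esub> a"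
    using N.r_coset_hom_Mod N.factorgroup_is_group is_group
    by (simp add: group_hom_def group_hom_axioms_def)
  have "lower_central (G Mod ?N) n = (\<lambda>a. ?N #>\<^bsub>G\<^esub> a) ` ?N"
    by (rule h.lower_central_img) (auto simp: FactGroup_def RCOSETS_def)
  also have "\<dots> = {\<one>\<^bsub>G Mod ?N\<^esub>}"
    using N.subgroup_axioms subgroup_nonempty N.rcos_const[OF is_group]
    by (force simp: FactGroup_def image_constant_conv)
  finally have "nilpotent_group (G Mod ?N)"
    unfolding nilpotent_group_def using N.factorgroup_is_group by blast
  moreover have "?N #>\<^bsub>G\<^esub> g \<noteq> \<one>\<^bsub>G Mod ?N\<^esub>"
    using n g rcos_self[OF g(1) N.subgroup_axioms] by (auto simp: FactGroup_def)
  ultimately show "\<exists>N. N \<lhd> G \<and> nilpotent_group (G Mod N) \<and> N #>\<^bsub>G\<^esub> g \<noteq> \<one>\<^bsub>G Mod N\<^esub>"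
    using N.normal_axioms by blast
qed fact

section \<open>Semidirect products and the projection to the integers\<close>

lemma mult_semidirect_int:
  "(k, u) \<otimes>\<^bsub>semidirect_int G \<phi>\<^esub> (l, v) = (k + l, (\<phi> [^]\<^bsub>AutoGroup G\<^esub> l) u \<otimes>\<^bsub>G\<^esub> v)"
  by (simp add: semidirect_int_def)

lemma carrier_semidirect_int: "carrier (semidirect_int G \<phi>) = UNIV \<times> carrier G"
  by (simp add: semidirect_int_def)

lemma one_semidirect_int: "\<one>\<^bsub>semidirect_int G \<phi>\<^esub> = (0, \<one>\<^bsub>G\<^esub>)"
  by (simp add: semidirect_int_def)

text \<open>The first component is a homomorphism to an abelian group and kills commutators. The
  index is \<open>Suc n\<close> because term \<open>0\<close> is the whole group.\<close>

lemma fst_lower_central_semidirect_int: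
  assumes "group G" "\<phi> \<in> auto G" "g \<in> lower_central (semidirect_int G \<phi>) (Suc n)"
  shows "fst g = 0"
proof -
  let ?S = "semidirect_int G \<phi>"
  interpret S: group ?S by (rule group_semidirect_int) fact+
  interpret h: group_hom ?S integer_group fst
    using S.is_group
    by (auto simp: group_hom_def group_hom_axioms_def hom_def semidirect_int_def)
  have "lower_central ?S n \<subseteq> carrier ?S"
    using S.lower_central_normal normal_imp_subgroup subgroup.subset by blast
  then have "a \<otimes>\<^bsub>?S\<^esub> b \<otimes>\<^bsub>?S\<^esub> inv\<^bsub>?S\<^esub> a \<otimes>\<^bsub>?S\<^esub> inv\<^bsub>?S\<^esub> b \<in> kernel ?S integer_group fst"
    if "a \<in> lower_central ?S n" "b \<in> carrier ?S" for a b
    using that h.hom_mult h.hom_inv by (simp add: kernel_def subset_iff del: fst_conv split_paired_All)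
  then have "lower_central ?S (Suc n) \<subseteq> kernel ?S integer_group fst"
    unfolding lower_central.simps
    by (intro S.generate_subgroup_incl h.subgroup_kernel subsetI) blast
  then show ?thesis using assms(3) by (auto simp: kernel_def)
qed

section \<open>Unipotent functions\<close>

locale automorphism_mod = F: group F for F (structure) +
  fixes \<psi> :: "'a \<Rightarrow> 'a" and p :: int
  assumes auto: "\<psi> \<in> auto F"
begin

abbreviation S :: "(int \<times> 'a) monoid" where
  "S \<equiv> semidirect_int F \<psi>"

text \<open>
  The right action of \<open>S\<close> on \<open>F\<close> in which \<open>F\<close> acts by right translations and the
  stable letter by \<open>\<psi>\<close>.
\<close>

definition act :: "'a \<Rightarrow> int \<times> 'a \<Rightarrow> 'a" where
  "act v g = (\<psi> [^]\<^bsub>AutoGroup F\<^esub> fst g) v \<otimes> snd g"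

sublocale S: group S
  by (rule group_semidirect_int[OF F.is_group auto])

sublocale A: group "AutoGroup F"
  by (rule F.AutoGroup)

lemma psi_in [simp]: "\<psi> \<in> carrier (AutoGroup F)"
  by (simp add: carrier_AutoGroup auto)

lemma pow_auto: "\<psi> [^]\<^bsub>AutoGroup F\<^esub> (k::int) \<in> auto F"
  using A.int_pow_closed[OF psi_in] by (simp add: carrier_AutoGroup)

lemma pow_closed [simp]: "v \<in> carrier F \<Longrightarrow> (\<psi> [^]\<^bsub>AutoGroup F\<^esub> (k::int)) v \<in> carrier F"
  using pow_auto[of k] by (auto simp: auto_def hom_def)

lemma pow_mult:
  "u \<in> carrier F \<Longrightarrow> v \<in> carrier F \<Longrightarrow>
    (\<psi> [^]\<^bsub>AutoGroup F\<^esub> (k::int)) (u \<otimes> v)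
      = (\<psi> [^]\<^bsub>AutoGroup F\<^esub> k) u \<otimes> (\<psi> [^]\<^bsub>AutoGroup F\<^esub> k) v"
  using pow_auto[of k] by (auto simp: auto_def hom_def)

lemma pow_one [simp]: "(\<psi> [^]\<^bsub>AutoGroup F\<^esub> (k::int)) \<one> = \<one>"
  using pow_auto[of k] F.is_group by (auto simp: auto_def intro: hom_one)

lemma psi_closed [simp]: "v \<in> carrier F \<Longrightarrow> \<psi> v \<in> carrier F"
  using pow_closed[of v 1] by simp

lemma psi_one [simp]: "\<psi> \<one> = \<one>"
  using pow_one[of 1] by simp

lemma psi_mult: "u \<in> carrier F \<Longrightarrow> v \<in> carrier F \<Longrightarrow> \<psi> (u \<otimes> v) = \<psi> u \<otimes> \<psi> v"
  using pow_mult[of u v 1] by simp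

lemma pow_add:
  "v \<in> carrier F \<Longrightarrow> (\<psi> [^]\<^bsub>AutoGroup F\<^esub> (k + l :: int)) v
    = (\<psi> [^]\<^bsub>AutoGroup F\<^esub> l) ((\<psi> [^]\<^bsub>AutoGroup F\<^esub> k) v)"
  using AutoGroup_mult_apply[OF pow_auto pow_auto, of v l k] A.int_pow_mult[OF psi_in, of l k]
  by (simp add: add.commute)

lemma act_closed [simp]: "v \<in> carrier F \<Longrightarrow> g \<in> carrier S \<Longrightarrow> act v g \<in> carrier F"
  by (auto simp: act_def carrier_semidirect_int)

lemma act_mult:
  assumes "v \<in> carrier F" "g \<in> carrier S" "h \<in> carrier S"
  shows "act v (g \<otimes>\<^bsub>S\<^esub> h) = act (act v g) h"
proof -
  obtain k u l w where gh: "g = (k, u)" "h = (l, w)" by fastforce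
  then have "u \<in> carrier F" "w \<in> carrier F" using assms by (auto simp: carrier_semidirect_int)
  then show ?thesis
    using assms(1) by (simp add: gh act_def mult_semidirect_int pow_add pow_mult F.m_assoc)
qed

lemma act_one [simp]: "v \<in> carrier F \<Longrightarrow> act v \<one>\<^bsub>S\<^esub> = v"
  by (simp add: act_def one_semidirect_int AutoGroup_one_apply)

lemma act_base [simp]: "v \<in> carrier F \<Longrightarrow> act v (0, u) = v \<otimes> u"
  by (simp add: act_def AutoGroup_one_apply)

lemma act_stable [simp]: "v \<in> carrier F \<Longrightarrow> act v (1, \<one>) = \<psi> v"
  by (simp add: act_def)

lemma act_inv:
  assumes "v \<in> carrier F" "g \<in> carrier S"
  shows "act (act v (inv\<^bsub>S\<^esub> g)) g = v" "act (act v g) (inv\<^bsub>S\<^esub> g) = v"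
  using assms by (simp_all add: act_mult[symmetric])

text \<open>
  The functions modulo \<open>p\<close> on \<open>F\<close> that are annihilated by all products of \<open>n\<close> factors
  \<open>g - 1\<close>, where \<open>g\<close> ranges over \<open>S\<close> and the left translations. The values are integers
  and only their classes modulo \<open>p\<close> on the carrier matter.
\<close>

primrec unip :: "nat \<Rightarrow> ('a \<Rightarrow> int) set" where
  "unip 0 = {f. \<forall>v\<in>carrier F. p dvd f v}"
| "unip (Suc n) = {f. (\<forall>g\<in>carrier S. (\<lambda>v. f (act v g) - f v) \<in> unip n) \<and>
     (\<forall>w\<in>carrier F. (\<lambda>v. f (w \<otimes> v) - f v) \<in> unip n)}"

declare unip.simps(2) [simp del]

lemma unip_act: "f \<in> unip (Suc n) \<Longrightarrow> g \<in> carrier S \<Longrightarrow> (\<lambda>v. f (act v g) - f v) \<in> unip n"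
  by (simp add: unip.simps)

lemma unip_left: "f \<in> unip (Suc n) \<Longrightarrow> w \<in> carrier F \<Longrightarrow> (\<lambda>v. f (w \<otimes> v) - f v) \<in> unip n"
  by (simp add: unip.simps)

lemma unip_lin: "f \<in> unip n \<Longrightarrow> g \<in> unip n \<Longrightarrow> (\<lambda>v. a * f v + b * g v) \<in> unip n"
proof (induction n arbitrary: f g)
  case (Suc n)
  have *: "(\<lambda>v. a * f (s v) + b * g (s v) - (a * f v + b * g v))
      = (\<lambda>v. a * (f (s v) - f v) + b * (g (s v) - g v))" for s
    by (simp add: algebra_simps)
  show ?case
    unfolding unip.simps using Suc by (simp add: * unip_act unip_left)
qed simp

lemma unip_add: "f \<in> unip n \<Longrightarrow> g \<in> unip n \<Longrightarrow> (\<lambda>v. f v + g v) \<in> unip n"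
  using unip_lin[of f n g 1 1] by simp

lemma unip_diff: "f \<in> unip n \<Longrightarrow> g \<in> unip n \<Longrightarrow> (\<lambda>v. f v - g v) \<in> unip n"
  using unip_lin[of f n g 1 "-1"] by simp

lemma unip_scale: "f \<in> unip n \<Longrightarrow> (\<lambda>v. a * f v) \<in> unip n"
  using unip_lin[of f n f a 0] by simp

lemma unip_minus: "f \<in> unip n \<Longrightarrow> (\<lambda>v. - f v) \<in> unip n"
  using unip_scale[of f n "-1"] by simp

lemma unip_zero: "(\<lambda>v. 0) \<in> unip n"
  by (induction n) (simp_all add: unip.simps)

lemma unip_sum: "(\<And>i. i \<in> I \<Longrightarrow> f i \<in> unip n) \<Longrightarrow> (\<lambda>v. \<Sum>i\<in>I. f i v) \<in> unip n"
  by (induction I rule: infinite_finite_induct) (simp_all add: unip_zero unip_add)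

lemma unip_Suc: "f \<in> unip n \<Longrightarrow> f \<in> unip (Suc n)"
  by (induction n arbitrary: f) (auto simp: unip.simps)

lemma unip_mono: "f \<in> unip m \<Longrightarrow> m \<le> n \<Longrightarrow> f \<in> unip n"
  by (rule lift_Suc_mono_le[of unip, THEN subsetD]) (auto intro: unip_Suc)

text \<open>A function with values divisible by \<open>p\<close> lies in \<open>unip 0\<close> and
  so in every \<open>unip n\<close>. This allows integer representatives to be exchanged modulo
  \<open>p\<close>.\<close>

lemma unip_cong:
  assumes "f \<in> unip n" "\<And>v. v \<in> carrier F \<Longrightarrow> p dvd g v - f v"
  shows "g \<in> unip n"
proof -
  have "(\<lambda>v. g v - f v) \<in> unip n"
    by (rule unip_mono[of _ 0]) (use assms in auto)
  from unip_add[OF assms(1) this] show ?thesis by simp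
qed

lemma unip_eqI: "f \<in> unip n \<Longrightarrow> (\<And>v. v \<in> carrier F \<Longrightarrow> g v = f v) \<Longrightarrow> g \<in> unip n"
  by (erule unip_cong) simp

lemma unip_comp_act: "f \<in> unip n \<Longrightarrow> g \<in> carrier S \<Longrightarrow> (\<lambda>v. f (act v g)) \<in> unip n"
  using unip_add[OF unip_act[OF unip_Suc], of f n g f] by simp

lemma unip_comp_left: "f \<in> unip n \<Longrightarrow> w \<in> carrier F \<Longrightarrow> (\<lambda>v. f (w \<otimes> v)) \<in> unip n"
  using unip_add[OF unip_left[OF unip_Suc], of f n w f] by simp

lemma base_in [simp]: "(k, u) \<in> carrier S \<longleftrightarrow> u \<in> carrier F"
  by (simp add: carrier_semidirect_int)

lemma unip_comp_right: "f \<in> unip n \<Longrightarrow> u \<in> carrier F \<Longrightarrow> (\<lambda>v. f (v \<otimes> u)) \<in> unip n"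
  using unip_comp_act[of f n "(0, u)"] by (rule unip_eqI) simp_all

lemma unip_right: "f \<in> unip (Suc n) \<Longrightarrow> u \<in> carrier F \<Longrightarrow> (\<lambda>v. f (v \<otimes> u) - f v) \<in> unip n"
  using unip_act[of f n "(0, u)"] by (rule unip_eqI) simp_all

lemma unip_const: "(\<lambda>v. c) \<in> unip (Suc n)"
  by (simp add: unip.simps unip_zero)

text \<open>Twisted Leibniz rule: in each summand of the difference of a product, one factor has
  dropped in order, so induction on \<open>m + n\<close> applies. The classes behave like
  polynomials of bounded degree.\<close>

lemma unip_mult:
  "f \<in> unip m \<Longrightarrow> g \<in> unip n \<Longrightarrow> (\<lambda>v. f v * g v) \<in> unip (m + n)"
proof (induction "m + n" arbitrary: m n f g)
  case 0
  then show ?case by simp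
next
  case (Suc k)
  consider "m = 0" | "n = 0" | m' n' where "m = Suc m'" "n = Suc n'" by (cases m; cases n) auto
  then show ?case
  proof cases
    case 1
    then have "(\<lambda>v. f v * g v) \<in> unip 0" using Suc.prems by auto
    then show ?thesis by (rule unip_mono) simp
  next
    case 2
    then have "(\<lambda>v. f v * g v) \<in> unip 0" using Suc.prems by auto
    then show ?thesis by (rule unip_mono) simp
  next
    case 3
    have *: "f (s v) * g (s v) - f v * g v = (f (s v) - f v) * g (s v) + f v * (g (s v) - g v)"
      for s v by (simp add: algebra_simps)
    have eq: "k = m' + n" "k = m + n'" "m + n = Suc k" using Suc 3 by simp_all
    have step: "(\<lambda>v. f (s v) * g (s v) - f v * g v) \<in> unip k"
      if "(\<lambda>v. f (s v) - f v) \<in> unip m'" "(\<lambda>v. g (s v) - g v) \<in> unip n'" "(\<lambda>v. g (s v)) \<in> unip n" for s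
      unfolding * using Suc.hyps(1)[OF eq(1) that(1,3)] Suc.hyps(1)[OF eq(2) Suc.prems(1) that(2)]
      by (simp add: eq(1,2)[symmetric] unip_add)
    have f: "f \<in> unip (Suc m')" and g: "g \<in> unip (Suc n')" using Suc.prems 3 by simp_all
    show ?thesis
      unfolding eq(3) unip.simps mem_Collect_eq
    proof (intro conjI ballI)
      fix s assume s: "s \<in> carrier S"
      show "(\<lambda>v. f (act v s) * g (act v s) - f v * g v) \<in> unip k"
        by (rule step[OF unip_act[OF f s] unip_act[OF g s] unip_comp_act[OF Suc.prems(2) s]])
    next
      fix w assume w: "w \<in> carrier F"
      show "(\<lambda>v. f (w \<otimes> v) * g (w \<otimes> v) - f v * g v) \<in> unip k"
        by (rule step[OF unip_left[OF f w] unip_left[OF g w] unip_comp_left[OF Suc.prems(2) w]])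
    qed
  qed
qed

text \<open>\<open>K\<close> consists of the \<open>g\<close> for which \<open>g - 1\<close> lowers
  every order by \<open>n\<close>. Closure follows from
  \<open>g h - 1 = g (h - 1) + (g - 1)\<close>, since the classes are invariant under the
  action.\<close>

lemma subgroup_unip_act:
  assumes K: "K = {g \<in> carrier S. \<forall>m f. f \<in> unip (m + n) \<longrightarrow> (\<lambda>v. f (act v g) - f v) \<in> unip m}"
  shows "subgroup K S"
proof
  show "K \<subseteq> carrier S" by (simp add: K)
  show "\<one>\<^bsub>S\<^esub> \<in> K" by (auto simp: K intro: unip_eqI[OF unip_zero])
next
  fix g h assume gh: "g \<in> K" "h \<in> K"
  have "(\<lambda>v. f (act v (g \<otimes>\<^bsub>S\<^esub> h)) - f v) \<in> unip m" if f: "f \<in> unip (m + n)" for m f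
  proof -
    have "(\<lambda>v. f (act (act v g) h) - f (act v g)) \<in> unip m"
      using gh f by (intro unip_comp_act[of "\<lambda>v. f (act v h) - f v"]) (auto simp: K)
    moreover have "(\<lambda>v. f (act v g) - f v) \<in> unip m" using gh f by (auto simp: K)
    ultimately show ?thesis
      by (rule unip_eqI[OF unip_add]) (use gh in \<open>simp add: K act_mult\<close>)
  qed
  then show "g \<otimes>\<^bsub>S\<^esub> h \<in> K" using gh by (simp add: K)
next
  fix g assume g: "g \<in> K"
  have "(\<lambda>v. f (act v (inv\<^bsub>S\<^esub> g)) - f v) \<in> unip m" if f: "f \<in> unip (m + n)" for m f
  proof -
    have "(\<lambda>v. f (act v g) - f v) \<in> unip m" using g f by (auto simp: K)
    from unip_minus[OF unip_comp_act[OF this, of "inv\<^bsub>S\<^esub> g"]]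
    show ?thesis by (rule unip_eqI) (use g in \<open>auto simp: K act_inv\<close>)
  qed
  then show "inv\<^bsub>S\<^esub> g \<in> K" using g by (simp add: K)
qed

text \<open>If \<open>a - 1\<close> lowers the order by \<open>n + 1\<close> and
  \<open>b - 1\<close> by one, then \<open>a b - b a = (a - 1) (b - 1) - (b - 1) (a - 1)\<close>
  lowers it by \<open>n + 2\<close>. Up to an invertible factor this is the commutator minus
  one.\<close>

lemma lower_central_unip:
  assumes "g \<in> lower_central S n" "f \<in> unip (m + Suc n)"
  shows "(\<lambda>v. f (act v g) - f v) \<in> unip m"
proof -
  let ?K = "\<lambda>n. {g \<in> carrier S. \<forall>m f. f \<in> unip (m + n) \<longrightarrow> (\<lambda>v. f (act v g) - f v) \<in> unip m}"
  have "lower_central S n \<subseteq> ?K (Suc n)"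
  proof (induction n)
    case 0
    then show ?case by (auto intro: unip_act)
  next
    case (Suc n)
    have "a \<otimes>\<^bsub>S\<^esub> b \<otimes>\<^bsub>S\<^esub> inv\<^bsub>S\<^esub> a \<otimes>\<^bsub>S\<^esub> inv\<^bsub>S\<^esub> b \<in> ?K (Suc (Suc n))"
      if "a \<in> lower_central S n" and b: "b \<in> carrier S" for a b
    proof -
      have a: "a \<in> carrier S" using \<open>a \<in> lower_central S n\<close> Suc by blast
      have aK: "(\<lambda>v. f (act v a) - f v) \<in> unip m" if "f \<in> unip (m + Suc n)" for m f
        using \<open>a \<in> lower_central S n\<close> Suc that by blast
      have "(\<lambda>v. f (act v (a \<otimes>\<^bsub>S\<^esub> b \<otimes>\<^bsub>S\<^esub> inv\<^bsub>S\<^esub> a \<otimes>\<^bsub>S\<^esub> inv\<^bsub>S\<^esub> b)) - f v) \<in> unip m"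
        if f: "f \<in> unip (m + Suc (Suc n))" for m f
      proof -
        \<comment> \<open>Shifting \<open>f\<close> by the inverse of \<open>b a\<close> turns the
          values of \<open>h\<close> along \<open>b a\<close> and \<open>a b\<close> into those of
          \<open>f\<close> at \<open>v\<close> and at \<open>v\<close> moved by the
          commutator.\<close>
        define h where "h = (\<lambda>v. f (act v (inv\<^bsub>S\<^esub> a \<otimes>\<^bsub>S\<^esub> inv\<^bsub>S\<^esub> b)))"
        \<comment> \<open>One membership with its index split in two ways, for the two orders of
          taking the differences by \<open>a\<close> and \<open>b\<close>.\<close>
        have h: "h \<in> unip (Suc (m + Suc n))" "h \<in> unip (Suc m + Suc n)"
          using unip_comp_act[OF f, of "inv\<^bsub>S\<^esub> a \<otimes>\<^bsub>S\<^esub> inv\<^bsub>S\<^esub> b"] a b by (simp_all add: h_def)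
        have "(\<lambda>v. (h (act (act v a) b) - h (act v a)) - (h (act v b) - h v)) \<in> unip m"
          using aK[OF unip_act[OF h(1) b]] .
        moreover have "(\<lambda>v. (h (act (act v b) a) - h (act v b)) - (h (act v a) - h v)) \<in> unip m"
          using unip_act[OF aK[OF h(2)] b] .
        ultimately have "(\<lambda>v. h (act (act v a) b) - h (act (act v b) a)) \<in> unip m"
          by (rule unip_eqI[OF unip_diff]) simp
        moreover have "inv\<^bsub>S\<^esub> a \<otimes>\<^bsub>S\<^esub> inv\<^bsub>S\<^esub> b = inv\<^bsub>S\<^esub> (b \<otimes>\<^bsub>S\<^esub> a)"
          using a b by (simp add: S.inv_mult_group)
        then have "h (act (act v b) a) = f v" if "v \<in> carrier F" for v
          using a b that by (simp add: h_def act_mult[symmetric])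
        moreover have "h (act (act v a) b) = f (act v (a \<otimes>\<^bsub>S\<^esub> b \<otimes>\<^bsub>S\<^esub> inv\<^bsub>S\<^esub> a \<otimes>\<^bsub>S\<^esub> inv\<^bsub>S\<^esub> b))"
          if "v \<in> carrier F" for v
          using a b that by (simp add: h_def act_mult[symmetric] S.m_assoc)
        ultimately show ?thesis by (elim unip_eqI) simp
      qed
      then show ?thesis using a b by simp
    qed
    then show ?case
      unfolding lower_central.simps
      by (intro S.generate_subgroup_incl subgroup_unip_act[OF refl] subsetI) blast
  qed
  then show ?thesis using assms by blast
qed

text \<open>\<open>F\<close> and the stable letter generate \<open>S\<close>, and the elements whose
  differences lie in \<open>unip n\<close> are closed under products. Thus \<open>(k, u)\<close> is
  reached from \<open>(0, u)\<close> by multiplying on the left by the stable letter or its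
  inverse.\<close>

lemma unip_SucI:
  assumes R: "\<And>u. u \<in> carrier F \<Longrightarrow> (\<lambda>v. f (v \<otimes> u) - f v) \<in> unip n"
    and T: "(\<lambda>v. f (\<psi> v) - f v) \<in> unip n"
    and L: "\<And>w. w \<in> carrier F \<Longrightarrow> (\<lambda>v. f (w \<otimes> v) - f v) \<in> unip n"
  shows "f \<in> unip (Suc n)"
proof -
  let ?P = "\<lambda>g. (\<lambda>v. f (act v g) - f v) \<in> unip n"
  have mult: "?P (g \<otimes>\<^bsub>S\<^esub> h)" if "?P g" "?P h" "g \<in> carrier S" "h \<in> carrier S" for g h
    by (rule unip_eqI[OF unip_add[OF unip_comp_act[OF that(2,3)] that(1)]])
      (use that in \<open>simp add: act_mult\<close>)
  let ?t = "(1, \<one>) :: int \<times> 'a"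
  have t: "?P ?t" by (rule unip_eqI[OF T]) simp
  have ti: "?P (inv\<^bsub>S\<^esub> ?t)"
    by (rule unip_eqI[OF unip_minus[OF unip_comp_act[OF t, of "inv\<^bsub>S\<^esub> ?t"]]])
      (use act_inv(1)[of _ ?t] in simp_all)
  have inv_t: "inv\<^bsub>S\<^esub> ?t = (-1, \<one>)"
    by (rule S.inv_equality) (simp_all add: mult_semidirect_int one_semidirect_int)
  have "?P (k, u)" if u: "u \<in> carrier F" for k u
  proof (induction k rule: int_induct[of _ 0])
    case base
    show ?case by (rule unip_eqI[OF R[OF u]]) simp
  next
    case (step1 i)
    have "?P (?t \<otimes>\<^bsub>S\<^esub> (i, u))" using mult[OF t step1(2)] u by simp
    then show ?case using u by (simp add: mult_semidirect_int add.commute)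
  next
    case (step2 i)
    have "?P ((-1, \<one>) \<otimes>\<^bsub>S\<^esub> (i, u))" using mult[OF ti step2(2)] u by (simp add: inv_t)
    then show ?case using u by (simp add: mult_semidirect_int)
  qed
  then show ?thesis using L by (auto simp: unip.simps carrier_semidirect_int)
qed

end

section \<open>Separation of points in free groups\<close>

lemma mult_free_group: "u \<otimes>\<^bsub>free_group\<^esub> v = foldr cons_red u v"
  by (simp add: free_group_def)

lemma one_free_group: "\<one>\<^bsub>free_group\<^esub> = []"
  by (simp add: free_group_def)

lemma carrier_free_group: "u \<in> carrier free_group \<longleftrightarrow> reduced u"
  by (simp add: free_group_def)

lemma reduced_append:
  "reduced (u @ v) \<longleftrightarrow> reduced u \<and> reduced v \<and>
     (u \<noteq> [] \<longrightarrow> v \<noteq> [] \<longrightarrow> hd v \<noteq> inv_letter (last u))"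
  by (auto simp: reduced_def successively_append_iff)

lemma mult_free_group_append: "reduced (u @ v) \<Longrightarrow> u \<otimes>\<^bsub>free_group\<^esub> v = u @ v"
  by (induction u) (auto simp: mult_free_group reduced_Cons cons_red_def)

lemma reduced_sublist: "reduced w \<Longrightarrow> reduced (drop i (take j w))"
  by (metis append_take_drop_id reduced_append)

lemma mult_free_gen_snoc:
  assumes "reduced w"
  shows "w \<otimes>\<^bsub>free_group\<^esub> free_gen c =
    (if w \<noteq> [] \<and> last w = (c, False) then butlast w else w @ [(c, True)])"
proof (cases "w \<noteq> [] \<and> last w = (c, False)")
  case True
  then obtain v where w: "w = v @ [(c, False)]" by (metis append_butlast_last_id)
  then have "w \<otimes>\<^bsub>free_group\<^esub> free_gen c = foldr cons_red v (foldr cons_red [(c, False)] [(c, True)])"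
    by (simp add: mult_free_group free_gen_def)
  also have "\<dots> = foldr cons_red v []" by (simp add: cons_red_def inv_letter_def)
  also have "\<dots> = v" using assms by (simp add: w reduced_append foldr_cons_red_Nil)
  finally show ?thesis by (simp add: w)
next
  case False
  then have "reduced (w @ [(c, True)])"
    using assms by (auto simp: reduced_append reduced_Cons inv_letter_def prod_eq_iff)
  then show ?thesis using False by (auto simp: free_gen_def mult_free_group_append)
qed

text \<open>
  The sum of \<open>g\<close> over the edges labelled \<open>a\<close> of the path from \<open>[]\<close> to \<open>w\<close> in the Cayley graph;
  an edge counts at the vertex where it starts, and negatively if it is traversed backwards.
\<close>

definition edge_sum :: "'a \<Rightarrow> (('a \<times> bool) list \<Rightarrow> int) \<Rightarrow> ('a \<times> bool) list \<Rightarrow> int" where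
  "edge_sum a g w = (\<Sum>i<length w.
     if w ! i = (a, True) then g (take i w)
     else if w ! i = (a, False) then - g (take (Suc i) w) else 0)"

lemma edge_sum_Nil: "edge_sum a g [] = 0"
  by (simp add: edge_sum_def)

lemma edge_sum_snoc:
  "edge_sum a g (w @ [l]) = edge_sum a g w +
     (if l = (a, True) then g w else if l = (a, False) then - g (w @ [l]) else 0)"
  by (auto simp: edge_sum_def nth_append intro!: sum.cong)

text \<open>Cancelling a final inverse letter removes a term \<open>- g w\<close>, because a
  backward edge is counted at the vertex where it ends in the path. Both cases therefore give the
  same increment.\<close>

lemma edge_sum_free_gen:
  assumes "reduced w"
  shows "edge_sum a g (w \<otimes>\<^bsub>free_group\<^esub> free_gen c) = edge_sum a g w + (if c = a then g w else 0)"
proof (cases "w \<noteq> [] \<and> last w = (c, False)")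
  case True
  then obtain v where "w = v @ [(c, False)]" by (metis append_butlast_last_id)
  then show ?thesis using assms by (simp add: mult_free_gen_snoc edge_sum_snoc)
next
  case False
  then show ?thesis using assms by (auto simp: mult_free_gen_snoc edge_sum_snoc)
qed

text \<open>
  A shortest non-trivial word \<open>u\<close> on which all functions agree with their value at \<open>[]\<close> is
  cyclically reduced, and its proper prefixes can be separated from each other. A product of
  functions separating the start of the first edge from the other vertices, integrated along
  edges, then separates \<open>u\<close> from \<open>[]\<close>.
\<close>

lemma free_group_separated:
  fixes P :: "(('a \<times> bool) list \<Rightarrow> int) set" and p :: int
  assumes p: "prime p"
    and const: "\<And>c. (\<lambda>v. c) \<in> P"
    and diff: "\<And>f g. f \<in> P \<Longrightarrow> g \<in> P \<Longrightarrow> (\<lambda>v. f v - g v) \<in> P"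
    and mult: "\<And>f g. f \<in> P \<Longrightarrow> g \<in> P \<Longrightarrow> (\<lambda>v. f v * g v) \<in> P"
    and left: "\<And>f w. f \<in> P \<Longrightarrow> reduced w \<Longrightarrow> (\<lambda>v. f (w \<otimes>\<^bsub>free_group\<^esub> v)) \<in> P"
    and right: "\<And>f w. f \<in> P \<Longrightarrow> reduced w \<Longrightarrow> (\<lambda>v. f (v \<otimes>\<^bsub>free_group\<^esub> w)) \<in> P"
    and integral: "\<And>f g. (\<And>c. g c \<in> P) \<Longrightarrow>
      (\<And>c w. reduced w \<Longrightarrow> f (w \<otimes>\<^bsub>free_group\<^esub> free_gen c) = f w + g c w) \<Longrightarrow> f \<in> P"
    and w: "reduced w" "w \<noteq> []"
  shows "\<exists>f\<in>P. \<not> p dvd f w - f []"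
proof (rule ccontr)
  interpret F: group "free_group :: ('a \<times> bool) list monoid" by (rule group_free_group)
  define N where "N = {u. reduced u \<and> u \<noteq> [] \<and> (\<forall>f\<in>P. p dvd f u - f [])}"
  assume "\<not> (\<exists>f\<in>P. \<not> p dvd f w - f [])"
  then have "w \<in> N" using w by (simp add: N_def)
  define u where "u = arg_min length (\<lambda>u. u \<in> N)"
  have uN: "u \<in> N" using arg_min_natI[of "\<lambda>u. u \<in> N", OF \<open>w \<in> N\<close>] by (simp add: u_def)
  have u_min: "length u \<le> length v" if "v \<in> N" for v
    using arg_min_nat_le[of "\<lambda>u. u \<in> N", OF that] by (simp add: u_def)
  have u: "reduced u" "u \<noteq> []" using uN by (auto simp: N_def)
  have uP: "p dvd f u - f []" if "f \<in> P" for f using uN that by (simp add: N_def)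
  \<comment> \<open>The subword between two prefixes is shorter than \<open>u\<close>, so minimality
    separates it from \<open>[]\<close>; a left translation moves this pair to the two
    prefixes.\<close>
  have sep: "\<exists>f\<in>P. \<not> p dvd f (take i u) - f (take j u)"
    if ij: "i < j" "j \<le> length u" "\<not> (i = 0 \<and> j = length u)" for i j
  proof -
    let ?s = "drop i (take j u)" and ?x = "take i u"
    have s: "reduced ?s" and x: "reduced ?x"
      using reduced_sublist[OF u(1), of i j] reduced_sublist[OF u(1), of 0 i] by simp_all
    have "length ?s = j - i" using ij by simp
    then have "?s \<noteq> []" "length ?s < length u" using ij by auto
    then have "?s \<notin> N" using u_min[of ?s] by linarith
    then obtain g where g: "g \<in> P" "\<not> p dvd g ?s - g []" using s \<open>?s \<noteq> []\<close> by (auto simp: N_def)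
    let ?f = "\<lambda>v. g (inv\<^bsub>free_group\<^esub> ?x \<otimes>\<^bsub>free_group\<^esub> v)"
    have "?x @ ?s = take j u"
      using ij by (metis append_take_drop_id less_imp_le_nat min.absorb1 take_take)
    moreover have "reduced (take j u)" using reduced_sublist[OF u(1), of 0 j] by simp
    ultimately have "take j u = ?x \<otimes>\<^bsub>free_group\<^esub> ?s" by (simp add: mult_free_group_append)
    then have "inv\<^bsub>free_group\<^esub> ?x \<otimes>\<^bsub>free_group\<^esub> take j u = ?s"
      using s x F.inv_solve_left'[of ?s ?x "take j u"] F.m_closed[of ?x ?s]
      by (simp add: carrier_free_group)
    then have "?f (take j u) = g ?s" by simp
    moreover have "?f ?x = g []" using x by (simp add: carrier_free_group one_free_group)
    moreover have "reduced (inv\<^bsub>free_group\<^esub> ?x)"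
      using F.inv_closed[of ?x] x by (simp add: carrier_free_group)
    then have "?f \<in> P" using left[OF g(1)] by blast
    ultimately show ?thesis using g(2) by (metis dvd_minus_iff minus_diff_eq)
  qed
  \<comment> \<open>Otherwise \<open>u\<close> is a conjugate of a shorter non-trivial word, which
    lies in \<open>N\<close> because \<open>P\<close> is invariant under translations on both
    sides.\<close>
  have cyc: "last u \<noteq> inv_letter (hd u)"
  proof
    assume last: "last u = inv_letter (hd u)"
    obtain l v where v: "u = l # v" using u(2) by (cases u) auto
    with last have "v \<noteq> []" by (cases v) auto
    then obtain s where s: "u = [l] @ s @ [inv_letter l]"
      using last v by (metis append_Cons append_Nil append_butlast_last_id last_ConsR list.sel(1))
    have red: "reduced s" "reduced [l]" "reduced [inv_letter l]" "reduced (s @ [inv_letter l])"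
      using u(1) unfolding s by (simp_all add: reduced_append reduced_Cons)
    have "s \<noteq> []" using u(1) by (auto simp: s reduced_Cons)
    have inv: "[inv_letter l] \<otimes>\<^bsub>free_group\<^esub> [l] = \<one>\<^bsub>free_group\<^esub>"
      by (simp add: mult_free_group one_free_group cons_red_def)
    have c: "s \<in> carrier free_group" "[l] \<in> carrier free_group" "[inv_letter l] \<in> carrier free_group"
      using red by (simp_all add: carrier_free_group)
    have "u = [l] \<otimes>\<^bsub>free_group\<^esub> (s \<otimes>\<^bsub>free_group\<^esub> [inv_letter l])"
      using u(1) red unfolding s by (simp add: mult_free_group_append)
    then have "[inv_letter l] \<otimes>\<^bsub>free_group\<^esub> u = s \<otimes>\<^bsub>free_group\<^esub> [inv_letter l]"
      using c by (simp add: F.m_assoc[symmetric] inv)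
    then have s_eq: "[inv_letter l] \<otimes>\<^bsub>free_group\<^esub> u \<otimes>\<^bsub>free_group\<^esub> [l] = s"
      using c by (simp add: F.m_assoc inv)
    have "p dvd f s - f []" if f: "f \<in> P" for f
    proof -
      let ?g = "\<lambda>v. f ([inv_letter l] \<otimes>\<^bsub>free_group\<^esub> v \<otimes>\<^bsub>free_group\<^esub> [l])"
      have "p dvd ?g u - ?g []" by (rule uP[OF left[OF right[OF f red(2)] red(3)]])
      moreover have "?g [] = f []"
        using inv red(3) by (simp add: carrier_free_group flip: one_free_group)
      ultimately show ?thesis using s_eq by simp
    qed
    then have "s \<in> N" using red \<open>s \<noteq> []\<close> by (simp add: N_def)
    then show False using u_min[of s] by (simp add: s)
  qed
  obtain a b where hd: "hd u = (a, b)" by fastforce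
  \<comment> \<open>The first edge is counted at the prefix of length \<open>e\<close>: at
    \<open>[]\<close> if the first letter is positive, after that letter if it is negative.\<close>
  define e where "e = (if b then 0 else 1 :: nat)"
  have e: "e \<le> length u" using u(2) by (cases u) (auto simp: e_def)
  \<comment> \<open>The prefixes to be separated from the one of length \<open>e\<close>. The pair
    \<open>[]\<close>, \<open>u\<close> is left out, as no function in \<open>P\<close> separates
    it.\<close>
  define I where "I = {i. i \<le> length u \<and> i \<noteq> e \<and> \<not> (e = 0 \<and> i = length u) \<and> \<not> (i = 0 \<and> e = length u)}"
  have "\<exists>f\<in>P. \<not> p dvd f (take e u) \<and> p dvd f (take i u)" if "i \<in> I" for i
  proof -
    have "\<exists>f\<in>P. \<not> p dvd f (take e u) - f (take i u)"
    proof (cases "e < i")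
      case True
      then show ?thesis using sep[of e i] that by (auto simp: I_def)
    next
      case False
      then have "\<exists>f\<in>P. \<not> p dvd f (take i u) - f (take e u)"
        using sep[of i e] that e by (auto simp: I_def)
      then show ?thesis by (metis dvd_minus_iff minus_diff_eq)
    qed
    then obtain f where "f \<in> P" "\<not> p dvd f (take e u) - f (take i u)" by blast
    then show ?thesis using diff[OF _ const, of f "f (take i u)"]
      by (intro bexI[of _ "\<lambda>v. f v - f (take i u)"]) auto
  qed
  then obtain h where h: "\<And>i. i \<in> I \<Longrightarrow> h i \<in> P" "\<And>i. i \<in> I \<Longrightarrow> \<not> p dvd h i (take e u)"
    "\<And>i. i \<in> I \<Longrightarrow> p dvd h i (take i u)" by metis
  define g where "g = (\<lambda>v. \<Prod>i\<in>I. h i v)"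
  have fin: "finite I" by (simp add: I_def)
  have "(\<lambda>v. \<Prod>i\<in>J. h i v) \<in> P" if "J \<subseteq> I" for J
    using finite_subset[OF that fin] that by (induction J) (simp_all add: const mult h(1))
  then have gP: "g \<in> P" by (simp add: g_def)
  have ge: "\<not> p dvd g (take e u)" using h(2) fin p by (simp add: g_def prime_dvd_prod_iff)
  have gi: "p dvd g (take i u)" if "i \<in> I" for i
    unfolding g_def using h(3)[OF that] dvd_prodI[OF fin that, of "\<lambda>j. h j (take i u)"] by (rule dvd_trans)
  let ?c = "\<lambda>i. if u ! i = (a, True) then g (take i u)
     else if u ! i = (a, False) then - g (take (Suc i) u) else 0"
  have "edge_sum a g \<in> P"
    by (rule integral[of "\<lambda>c. if c = a then g else (\<lambda>v. 0)"])
      (auto simp: gP const edge_sum_free_gen)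
  then have "p dvd edge_sum a g u" by (auto dest: uP simp: edge_sum_Nil)
  moreover have "edge_sum a g u = ?c 0 + (\<Sum>i\<in>{1..<length u}. ?c i)"
    using u(2) by (simp add: edge_sum_def lessThan_atLeast0 sum.atLeast_Suc_lessThan)
  \<comment> \<open>Every later edge labelled \<open>a\<close> is counted at a vertex in
    \<open>I\<close>: reducedness keeps it away from \<open>e\<close>, and \<open>cyc\<close> keeps
    it away from the end of \<open>u\<close> when \<open>e = 0\<close>.\<close>
  moreover have "p dvd ?c i" if i: "i \<in> {1..<length u}" for i
  proof (cases "u ! i = (a, True)")
    case True
    have "i \<noteq> e"
    proof
      assume "i = e"
      then have b: "\<not> b" and "i = 1" using i by (auto simp: e_def split: if_splits)
      then obtain v where "u = (a, False) # (a, True) # v"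
        using hd True i by (cases u; cases "tl u") auto
      then show False using u(1) by (simp add: reduced_Cons inv_letter_def)
    qed
    then show ?thesis using True i gi[of i] by (auto simp: I_def)
  next
    case False
    have "Suc i \<in> I" if "u ! i = (a, False)"
    proof -
      have "last u = (a, False)" if "Suc i = length u"
        using \<open>u ! i = (a, False)\<close> u(2) that by (metis diff_Suc_1 last_conv_nth)
      then show ?thesis using i cyc hd by (auto simp: I_def e_def inv_letter_def)
    qed
    then show ?thesis using False gi[of "Suc i"] by auto
  qed
  then have "p dvd (\<Sum>i\<in>{1..<length u}. ?c i)" by (rule dvd_sum)
  \<comment> \<open>Only the first edge remains, and its contribution is \<open>g (take e u)\<close>
    up to sign, which is prime to \<open>p\<close> by \<open>ge\<close>.\<close>
  ultimately have "p dvd ?c 0" by (simp only: dvd_add_left_iff)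
  moreover have "?c 0 = g (take e u) \<or> ?c 0 = - g (take e u)"
    using hd u(2) by (cases b) (auto simp: e_def hd_conv_nth)
  ultimately show False using ge by (elim disjE) (simp_all only: dvd_minus_iff)
qed

section \<open>Integration of unipotent functions\<close>

definition exponent_sum :: "'a \<Rightarrow> ('a \<times> bool) list \<Rightarrow> int" where
  "exponent_sum j = free_lift integer_group (\<lambda>i. if i = j then 1 else 0)"

lemma group_hom_exponent_sum: "group_hom free_group integer_group (exponent_sum j)"
  by (simp add: group_hom_def group_hom_axioms_def exponent_sum_def group_free_group free_lift_hom(1))

lemma exponent_sum_free_gen: "exponent_sum j (free_gen i) = (if i = j then 1 else 0)"
  unfolding exponent_sum_def by (rule free_lift_hom(2)) simp_all

lemma exponent_sum_mult:
  "u \<in> carrier free_group \<Longrightarrow> v \<in> carrier free_group \<Longrightarrow>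
    exponent_sum j (u \<otimes>\<^bsub>free_group\<^esub> v) = exponent_sum j u + exponent_sum j v"
  using group_hom.hom_mult[OF group_hom_exponent_sum] by simp

lemma exponent_sum_one: "exponent_sum j \<one>\<^bsub>free_group\<^esub> = 0"
  using group_hom.hom_one[OF group_hom_exponent_sum, of j] by simp

lemma exponent_sum_inv:
  "u \<in> carrier free_group \<Longrightarrow> exponent_sum j (inv\<^bsub>free_group\<^esub> u) = - exponent_sum j u"
  using group_hom.hom_inv[OF group_hom_exponent_sum] by simp

lemma free_group_induct [consumes 1, case_names one gen inv mult]:
  assumes "u \<in> carrier free_group"
    and "P \<one>\<^bsub>free_group\<^esub>" "\<And>j. P (free_gen j)" "\<And>j. P (inv\<^bsub>free_group\<^esub> (free_gen j))"
    and "\<And>u v. u \<in> carrier free_group \<Longrightarrow> v \<in> carrier free_group \<Longrightarrow> P u \<Longrightarrow> P v \<Longrightarrow>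
      P (u \<otimes>\<^bsub>free_group\<^esub> v)"
  shows "P u"
proof -
  have "u \<in> generate free_group (range free_gen)" using assms(1) generate_free_gen by blast
  then show ?thesis
  proof (induction rule: generate.induct)
    case (eng u v)
    then show ?case using assms(5)[of u v] by (simp add: generate_free_gen)
  qed (use assms in auto)
qed

text \<open>The assumption \<open>square\<close> is \<open>(M - 1)^2 = 0\<close> modulo
  \<open>p\<close>, written in entries, for the matrix \<open>M\<close> of \<psi> on the
  abelianization.\<close>

locale free_automorphism_mod = automorphism_mod free_group \<psi> p
  for \<psi> :: "('a::finite \<times> bool) list \<Rightarrow> ('a \<times> bool) list" and p +
  assumes square: "\<And>j k. p dvd (\<Sum>i\<in>UNIV.
    (exponent_sum k (\<psi> (free_gen i)) - (if i = k then 1 else 0)) *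
    (exponent_sum i (\<psi> (free_gen j)) - (if j = i then 1 else 0)))"
begin

text \<open>The derivative along the edges labelled \<open>j\<close> of the Cayley graph;
  \<open>edge_sum\<close> produces functions with prescribed derivatives.\<close>

definition fox :: "'a \<Rightarrow> (('a \<times> bool) list \<Rightarrow> int) \<Rightarrow> ('a \<times> bool) list \<Rightarrow> int" where
  "fox j f = (\<lambda>v. f (v \<otimes>\<^bsub>free_group\<^esub> free_gen j) - f v)"

abbreviation unipotent_part :: "'a \<Rightarrow> 'a \<Rightarrow> int" where
  "unipotent_part i j \<equiv> exponent_sum i (\<psi> (free_gen j)) - (if j = i then 1 else 0)"

lemma inv_right:
  assumes "v \<in> carrier free_group"
  shows "f (v \<otimes>\<^bsub>free_group\<^esub> inv\<^bsub>free_group\<^esub> (free_gen j)) - f v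
    = - fox j f (v \<otimes>\<^bsub>free_group\<^esub> inv\<^bsub>free_group\<^esub> (free_gen j))"
  using assms by (simp add: fox_def F.m_assoc)

text \<open>The difference along a product is the difference along the second factor, translated by
  the first, plus that along the first. Hence the generators control all right translations.\<close>

lemma unip_right_of_fox:
  assumes "\<And>j. fox j f \<in> unip n" "u \<in> carrier free_group"
  shows "(\<lambda>v. f (v \<otimes>\<^bsub>free_group\<^esub> u) - f v) \<in> unip n"
  using assms(2)
proof (induction u rule: free_group_induct)
  case one
  show ?case by (rule unip_eqI[OF unip_zero]) simp
next
  case (gen j)
  then show ?case using assms(1)[of j] by (simp add: fox_def)
next
  case (inv j)
  show ?case
    by (rule unip_eqI[OF unip_minus[OF unip_comp_right[OF assms(1)[of j]]]]) (auto simp: inv_right)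
next
  case (mult u v)
  show ?case
    by (rule unip_eqI[OF unip_add[OF unip_comp_right[OF mult(4,1)] mult(3)]])
      (use mult in \<open>simp add: F.m_assoc\<close>)
qed

text \<open>The fundamental formula of Fox calculus to first order.\<close>

lemma unip_right_expansion:
  assumes "\<And>j. fox j f \<in> unip (Suc n)" "u \<in> carrier free_group"
  shows "(\<lambda>v. f (v \<otimes>\<^bsub>free_group\<^esub> u) - f v - (\<Sum>j\<in>UNIV. exponent_sum j u * fox j f v)) \<in> unip n"
  using assms(2)
proof (induction u rule: free_group_induct)
  case one
  show ?case by (rule unip_eqI[OF unip_zero]) (simp add: exponent_sum_one)
next
  case (gen j)
  then show ?case
    by (simp add: exponent_sum_free_gen if_distrib[of "\<lambda>x. x * _"] fox_def unip_zero cong: if_cong)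
next
  case (inv j)
  let ?i = "inv\<^bsub>free_group\<^esub> (free_gen j)"
  have i: "?i \<in> carrier free_group" by simp
  have eq: "(\<Sum>k\<in>UNIV. exponent_sum k ?i * fox k f v) = - fox j f v" for v
    by (simp add: exponent_sum_inv exponent_sum_free_gen sum_negf if_distrib[of "\<lambda>x. x * _"] cong: if_cong)
  show ?case
    by (rule unip_eqI[OF unip_minus[OF unip_right[OF assms(1)[of j] i]]])
      (simp add: eq inv_right[of _ f])
next
  case (mult u w)
  \<comment> \<open>The expansion for \<open>w\<close> involves derivatives at the translate of
    \<open>v\<close> by \<open>u\<close>; replacing them by derivatives at \<open>v\<close> costs a
    right difference, which has lower order.\<close>
  have "(\<lambda>v. \<Sum>j\<in>UNIV. exponent_sum j w * (fox j f (v \<otimes>\<^bsub>free_group\<^esub> u) - fox j f v)) \<in> unip n"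
    using mult(1) by (intro unip_sum unip_scale unip_right assms(1))
  from unip_add[OF unip_add[OF unip_comp_right[OF mult(4,1)] mult(3)] this]
  show ?case
    by (rule unip_eqI) (use mult(1,2) in \<open>simp add: F.m_assoc exponent_sum_mult algebra_simps
      sum.distrib sum_subtractf\<close>)
qed

text \<open>With \<open>?h\<close> the difference along \<open>\<psi> (free_gen j)\<close>, the
  derivative of \<open>f \<circ> \<psi>\<close> at \<open>v\<close> is \<open>?h (\<psi> v)\<close>.
  This agrees with \<open>?h v\<close> up to lower order, and the first-order expansion applies to
  \<open>?h v\<close>.\<close>

lemma fox_stable:
  assumes f: "\<And>j. fox j f \<in> unip (Suc n)"
  shows "(\<lambda>v. fox j (\<lambda>v. f (\<psi> v) - f v) v - (\<Sum>i\<in>UNIV. unipotent_part i j * fox i f v)) \<in> unip n"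
proof -
  let ?u = "\<psi> (free_gen j)"
  let ?h = "\<lambda>v. f (v \<otimes>\<^bsub>free_group\<^esub> ?u) - f v"
  have "?h \<in> unip (Suc n)" by (rule unip_right_of_fox[OF f]) simp
  from unip_act[OF this, of "(1, \<one>\<^bsub>free_group\<^esub>)"]
  have "(\<lambda>v. ?h (\<psi> v) - ?h v) \<in> unip n" by (rule unip_eqI) simp_all
  from unip_add[OF this unip_right_expansion[OF f, of ?u]]
  have *: "(\<lambda>v. ?h (\<psi> v) - (\<Sum>i\<in>UNIV. exponent_sum i ?u * fox i f v)) \<in> unip n"
    by (rule unip_eqI) simp_all
  have eq: "(\<Sum>i\<in>UNIV. unipotent_part i j * fox i f v)
      = (\<Sum>i\<in>UNIV. exponent_sum i ?u * fox i f v) - fox j f v" for v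
    by (simp add: left_diff_distrib sum_subtractf if_distrib[of "\<lambda>x. x * _"] cong: if_cong)
  show ?thesis
    unfolding eq by (rule unip_eqI[OF *]) (simp add: fox_def psi_mult)
qed

text \<open>
  Up to lower order, passing from \<open>f\<close> to \<open>f \<circ> \<psi> - f\<close> applies \<open>unipotent_part\<close> to the vector of
  Fox derivatives. Its square vanishes modulo \<open>p\<close>, so doing it twice lowers the order of
  the derivatives.
\<close>

lemma unip_integral: "\<exists>N\<ge>n. \<forall>f. (\<forall>j. fox j f \<in> unip n) \<longrightarrow> f \<in> unip N"
proof (induction n)
  case 0
  \<comment> \<open>A function whose derivatives all vanish modulo \<open>p\<close> is constant
    modulo \<open>p\<close>.\<close>
  have "f \<in> unip 1" if "\<forall>j. fox j f \<in> unip 0" for f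
  proof -
    have "p dvd f v - f \<one>\<^bsub>free_group\<^esub>" if "v \<in> carrier free_group" for v
      using unip_right_of_fox[of f 0 v] \<open>\<forall>j. fox j f \<in> unip 0\<close> that
      by (auto dest: bspec[of _ _ "\<one>\<^bsub>free_group\<^esub>"])
    then show ?thesis using unip_cong[OF unip_const[of "f \<one>\<^bsub>free_group\<^esub>" 0]] by simp
  qed
  then show ?case by (intro exI[of _ 1]) simp
next
  case (Suc n)
  then obtain N where "n \<le> N" and "\<And>f. \<forall>j. fox j f \<in> unip n \<Longrightarrow> f \<in> unip N" by blast
  then have N: "f \<in> unip (Suc N)" if "\<And>j. fox j f \<in> unip n" for f
    using that unip_Suc by blast
  have "Suc n \<le> Suc N" using \<open>n \<le> N\<close> by simp
  have R: "(\<lambda>v. f (v \<otimes>\<^bsub>free_group\<^esub> u) - f v) \<in> unip (Suc N)"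
    if "\<And>j. fox j f \<in> unip (Suc n)" "u \<in> carrier free_group" for f u
    using unip_right_of_fox[OF that] \<open>Suc n \<le> Suc N\<close> by (rule unip_mono)
  \<comment> \<open>Left translations commute with \<open>fox j\<close>, so the derivatives of a
    left difference are left differences of derivatives and have order \<open>n\<close>, where the
    induction hypothesis applies.\<close>
  have L: "(\<lambda>v. f (w \<otimes>\<^bsub>free_group\<^esub> v) - f v) \<in> unip (Suc N)"
    if "\<And>j. fox j f \<in> unip (Suc n)" "w \<in> carrier free_group" for f w
  proof (rule N)
    fix j
    show "fox j (\<lambda>v. f (w \<otimes>\<^bsub>free_group\<^esub> v) - f v) \<in> unip n"
      by (rule unip_eqI[OF unip_left[OF that(1)[of j] that(2)]])
        (use that(2) in \<open>simp add: fox_def F.m_assoc\<close>)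
  qed
  define D where "D = (\<lambda>f v. f (\<psi> v) - f v :: int)"
  have D_eq: "D f = (\<lambda>v. f (\<psi> v) - f v)" for f by (simp add: D_def)
  have D: "(\<lambda>v. fox j (D f) v - (\<Sum>i\<in>UNIV. unipotent_part i j * fox i f v)) \<in> unip n"
    if "\<And>j. fox j f \<in> unip (Suc n)" for f j
    using fox_stable[OF that] by (simp add: D_def)
  have D_Suc: "fox j (D f) \<in> unip (Suc n)" if f: "\<And>j. fox j f \<in> unip (Suc n)" for f j
  proof -
    have "(\<lambda>v. \<Sum>i\<in>UNIV. unipotent_part i j * fox i f v) \<in> unip (Suc n)"
      by (intro unip_sum unip_scale f)
    from unip_add[OF unip_Suc[OF D[OF f, of j]] this] show ?thesis by simp
  qed
  have "f \<in> unip (Suc (Suc (Suc N)))" if "\<forall>j. fox j f \<in> unip (Suc n)" for f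
  proof -
    have f: "fox j f \<in> unip (Suc n)" for j using that by blast
    have "fox j (D (D f)) \<in> unip n" for j
    proof -
      have "(\<lambda>v. \<Sum>i\<in>UNIV. unipotent_part i j *
          (fox i (D f) v - (\<Sum>k\<in>UNIV. unipotent_part k i * fox k f v))) \<in> unip n"
        by (intro unip_sum unip_scale D f)
      from unip_add[OF D[OF D_Suc[OF f], of j] this]
      have *: "(\<lambda>v. fox j (D (D f)) v - (\<Sum>i\<in>UNIV. unipotent_part i j *
          (\<Sum>k\<in>UNIV. unipotent_part k i * fox k f v))) \<in> unip n"
        by (simp add: right_diff_distrib sum_subtractf)
      have "(\<Sum>i\<in>UNIV. unipotent_part i j * (\<Sum>k\<in>UNIV. unipotent_part k i * fox k f v))
        = (\<Sum>k\<in>UNIV. (\<Sum>i\<in>UNIV. unipotent_part k i * unipotent_part i j) * fox k f v)" for v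
        unfolding sum_distrib_left sum_distrib_right
        by (subst sum.swap) (simp add: ac_simps)
      then have "p dvd (\<Sum>i\<in>UNIV. unipotent_part i j * (\<Sum>k\<in>UNIV. unipotent_part k i * fox k f v))" for v
        by (simp only:) (rule dvd_sum, rule dvd_mult2, rule square)
      then show ?thesis by (intro unip_cong[OF *]) simp
    qed
    \<comment> \<open>From here the order is recovered in two steps: \<open>unip_SucI\<close> passes
      from \<open>D (D f)\<close> to \<open>D f\<close>, and then from \<open>D f\<close> to
      \<open>f\<close>.\<close>
    then have "D (D f) \<in> unip (Suc N)" by (rule N)
    then have "(\<lambda>v. D f (\<psi> v) - D f v) \<in> unip (Suc N)" by (simp only: D_eq[of "D f"])
    then have "D f \<in> unip (Suc (Suc N))"
      by - (rule unip_SucI, erule R[OF D_Suc[OF f]], assumption, erule L[OF D_Suc[OF f]])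
    then have "(\<lambda>v. f (\<psi> v) - f v) \<in> unip (Suc (Suc N))" by (simp only: D_eq)
    then show ?thesis
      by - (rule unip_SucI, erule unip_Suc[OF R[OF f]], assumption, erule unip_Suc[OF L[OF f]])
  qed
  then show ?case using \<open>n \<le> N\<close> by (intro exI[of _ "Suc (Suc (Suc N))"]) simp
qed

end

section \<open>Index and trace\<close>

text \<open>An element of every term has the form \<open>(0, u)\<close> and fixes every unipotent
  function modulo \<open>p\<close>, whereas some unipotent function separates \<open>u\<close> from
  \<open>[]\<close>.\<close>

lemma (in free_automorphism_mod) lower_central_trivial_Inter:
  assumes p: "prime p" and g: "g \<in> carrier S" "g \<noteq> \<one>\<^bsub>S\<^esub>"
  shows "\<exists>n. g \<notin> lower_central S n"
proof (rule ccontr)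
  assume "\<nexists>n. g \<notin> lower_central S n"
  then have lc: "g \<in> lower_central S n" for n by blast
  obtain k u where ku: "g = (k, u)" by fastforce
  have k: "k = 0"
    using fst_lower_central_semidirect_int[OF group_free_group auto lc[of "Suc 0"]] by (simp add: ku)
  then have u: "u \<in> carrier free_group" "u \<noteq> []"
    using g by (auto simp: ku one_semidirect_int one_free_group)
  have "\<exists>f \<in> (\<Union>n. unip n). \<not> p dvd f u - f []"
  proof (rule free_group_separated[OF p])
    show "reduced u" "u \<noteq> []" using u by (simp_all add: carrier_free_group)
    show "(\<lambda>v. c) \<in> (\<Union>n. unip n)" for c using unip_const[of c 0] by blast
    show "(\<lambda>v. f v - g v) \<in> (\<Union>n. unip n)" if fg: "f \<in> (\<Union>n. unip n)" "g \<in> (\<Union>n. unip n)" for f g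
    proof -
      obtain m n where "f \<in> unip m" "g \<in> unip n" using fg by blast
      then have "f \<in> unip (max m n)" "g \<in> unip (max m n)" by (auto intro: unip_mono)
      then show ?thesis using unip_diff by blast
    qed
    show "(\<lambda>v. f v * g v) \<in> (\<Union>n. unip n)" if "f \<in> (\<Union>n. unip n)" "g \<in> (\<Union>n. unip n)" for f g
      using that unip_mult by blast
    show "(\<lambda>v. f (w \<otimes>\<^bsub>free_group\<^esub> v)) \<in> (\<Union>n. unip n)" if "f \<in> (\<Union>n. unip n)" "reduced w" for f w
      using that unip_comp_left by (auto simp: carrier_free_group)
    show "(\<lambda>v. f (v \<otimes>\<^bsub>free_group\<^esub> w)) \<in> (\<Union>n. unip n)" if "f \<in> (\<Union>n. unip n)" "reduced w" for f w
      using that unip_comp_right by (auto simp: carrier_free_group)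
    show "f \<in> (\<Union>n. unip n)"
      if g: "\<And>c. g c \<in> (\<Union>n. unip n)"
        and f: "\<And>c w. reduced w \<Longrightarrow> f (w \<otimes>\<^bsub>free_group\<^esub> free_gen c) = f w + g c w" for f g
    proof -
      obtain m where m: "g c \<in> unip (m c)" for c using g by (simp add: Bex_def) metis
      \<comment> \<open>There are finitely many generators, so one order bounds all
        derivatives.\<close>
      have "m c \<le> Max (range m)" for c by simp
      then have "fox c f \<in> unip (Max (range m))" for c
        by (intro unip_mono[OF unip_eqI[OF m[of c]]]) (simp_all add: fox_def f carrier_free_group)
      then show ?thesis using unip_integral[of "Max (range m)"] by blast
    qed
  qed
  then obtain f n where f: "f \<in> unip n" "\<not> p dvd f u - f []" by blast
  \<comment> \<open>Order \<open>0\<close> is the target: membership in \<open>unip 0\<close> is a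
    congruence, to be read off at the identity.\<close>
  have "f \<in> unip (0 + Suc n)" using f(1) by (simp add: unip_Suc)
  from lower_central_unip[OF lc this] have "p dvd f (act \<one>\<^bsub>free_group\<^esub> g) - f \<one>\<^bsub>free_group\<^esub>"
    using F.one_closed by (simp del: F.one_closed)
  then show False using f(2) u(1) by (simp add: ku k one_free_group[symmetric])
qed

section \<open>Transport along isomorphisms and subgroups of finite index\<close>

lemma residually_nilpotent_iso:
  assumes "group G" "group H" and h: "h \<in> iso G H"
    and lc: "\<And>g. g \<in> carrier G \<Longrightarrow> g \<noteq> \<one>\<^bsub>G\<^esub> \<Longrightarrow> \<exists>n. g \<notin> lower_central G n"
  shows "residually_nilpotent H"
proof (rule residually_nilpotentI[OF \<open>group H\<close>])
  interpret h: group_hom G H h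
    using assms by (simp add: group_hom_def group_hom_axioms_def iso_def)
  have inj: "inj_on h (carrier G)" and surj: "h ` carrier G = carrier H"
    using h by (auto simp: iso_def bij_betw_def)
  fix y assume y: "y \<in> carrier H" "y \<noteq> \<one>\<^bsub>H\<^esub>"
  then obtain x where x: "x \<in> carrier G" "y = h x" using surj by blast
  then have "x \<noteq> \<one>\<^bsub>G\<^esub>" using y(2) h.hom_one by metis
  then obtain n where n: "x \<notin> lower_central G n" using lc[OF x(1)] by blast
  have "lower_central G n \<subseteq> carrier G"
    using h.G.lower_central_normal normal_imp_subgroup subgroup.subset by blast
  then have "y \<notin> h ` lower_central G n" using n x inj by (auto dest: inj_onD)
  then show "\<exists>n. y \<notin> lower_central H n" using h.lower_central_img[OF surj] by blast
qed

text \<open>The power \<open>m\<close> of the stable letter acts as \<open>\<phi>\<close> to the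
  power \<open>m\<close>, which gives the isomorphism. The cosets are the residue classes
  \<open>C r\<close> of the first component modulo \<open>m\<close>.\<close>

lemma semidirect_int_pow_subgroup:
  assumes "group G" "\<phi> \<in> auto G" and m: "m > 0"
  defines "H \<equiv> {(k, u). int m dvd k \<and> u \<in> carrier G}"
  shows "subgroup H (semidirect_int G \<phi>)"
    and "card (rcosets\<^bsub>semidirect_int G \<phi>\<^esub> H) = m"
    and "(\<lambda>(k, u). (int m * k, u)) \<in>
      iso (semidirect_int G (\<phi> [^]\<^bsub>AutoGroup G\<^esub> m)) ((semidirect_int G \<phi>)\<lparr>carrier := H\<rparr>)"
proof -
  let ?S = "semidirect_int G \<phi>" and ?T = "semidirect_int G (\<phi> [^]\<^bsub>AutoGroup G\<^esub> m)"
  let ?h = "\<lambda>(k, u). (int m * k, u)"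
  interpret G: group G by fact
  interpret A: group "AutoGroup G" by (rule G.AutoGroup)
  have phi: "\<phi> \<in> carrier (AutoGroup G)" using assms by (simp add: carrier_AutoGroup)
  then have "\<phi> [^]\<^bsub>AutoGroup G\<^esub> m \<in> auto G"
    using A.nat_pow_closed by (simp add: carrier_AutoGroup)
  interpret S: group ?S by (rule group_semidirect_int) fact+
  interpret T: group ?T by (rule group_semidirect_int) fact+
  have pow: "(\<phi> [^]\<^bsub>AutoGroup G\<^esub> m) [^]\<^bsub>AutoGroup G\<^esub> (l::int) = \<phi> [^]\<^bsub>AutoGroup G\<^esub> (int m * l)" for l
    using A.int_pow_pow[OF phi, of "int m" l] by (simp add: int_pow_int)
  have hom: "?h \<in> hom ?T ?S"
    by (auto simp: hom_def carrier_semidirect_int mult_semidirect_int pow distrib_left)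
  interpret h: group_hom ?T ?S ?h
    using hom T.is_group S.is_group by (simp add: group_hom_def group_hom_axioms_def)
  have H: "H = ?h ` carrier ?T"
    by (force simp: H_def carrier_semidirect_int elim: dvdE)
  show sub: "subgroup H ?S" unfolding H by (rule h.subgroup_img_is_subgroup[OF T.subgroup_self])
  have "inj_on ?h (carrier ?T)" using m by (auto simp: inj_on_def)
  then show "?h \<in> iso ?T (?S\<lparr>carrier := H\<rparr>)"
    using hom H by (auto simp: iso_def hom_def bij_betw_def)
  define C where "C = (\<lambda>r. {(k, u). k mod int m = r \<and> u \<in> carrier G})"
  interpret f: group_hom ?S integer_group fst
    using S.is_group by (auto simp: group_hom_def group_hom_axioms_def hom_def semidirect_int_def)
  have coset: "H #>\<^bsub>?S\<^esub> x = C (fst x mod int m)" if x: "x \<in> carrier ?S" for x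
  proof (intro equalityI subsetI)
    fix y assume "y \<in> H #>\<^bsub>?S\<^esub> x"
    then obtain z where z: "z \<in> H" "y = z \<otimes>\<^bsub>?S\<^esub> x" by (auto simp: r_coset_def)
    then have zc: "z \<in> carrier ?S" using sub subgroup.mem_carrier by fast
    have "y \<in> carrier ?S" using z zc x by simp
    moreover have "fst y = fst z + fst x" using z(2) f.hom_mult[OF zc x] by simp
    moreover have "int m dvd fst z" using z(1) by (auto simp: H_def)
    ultimately show "y \<in> C (fst x mod int m)"
      by (auto simp: C_def carrier_semidirect_int mod_add_left_eq[symmetric] dvd_imp_mod_0)
  next
    fix y assume y: "y \<in> C (fst x mod int m)"
    then have yc: "y \<in> carrier ?S" by (auto simp: C_def carrier_semidirect_int)
    let ?z = "y \<otimes>\<^bsub>?S\<^esub> inv\<^bsub>?S\<^esub> x"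
    have zc: "?z \<in> carrier ?S" using yc x by simp
    have "fst ?z = fst y - fst x" using f.hom_mult[of y "inv\<^bsub>?S\<^esub> x"] f.hom_inv[OF x] yc x by simp
    moreover have "fst y mod int m = fst x mod int m" using y by (auto simp: C_def)
    ultimately have "int m dvd fst ?z" by (simp add: mod_eq_dvd_iff)
    then have "?z \<in> H" using zc by (cases ?z) (simp add: H_def carrier_semidirect_int)
    moreover have "y = ?z \<otimes>\<^bsub>?S\<^esub> x" using yc x by (simp add: S.m_assoc)
    ultimately show "y \<in> H #>\<^bsub>?S\<^esub> x" by (auto simp: r_coset_def)
  qed
  have "rcosets\<^bsub>?S\<^esub> H = C ` {0..<int m}"
  proof (intro equalityI subsetI)
    fix X assume "X \<in> rcosets\<^bsub>?S\<^esub> H"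
    then show "X \<in> C ` {0..<int m}" using coset m by (auto simp: RCOSETS_def)
  next
    fix X assume "X \<in> C ` {0..<int m}"
    then obtain r where r: "0 \<le> r" "r < int m" "X = C r" by auto
    have x: "(r, \<one>\<^bsub>G\<^esub>) \<in> carrier ?S" by (simp add: carrier_semidirect_int)
    have "X = H #>\<^bsub>?S\<^esub> (r, \<one>\<^bsub>G\<^esub>)" using coset[OF x] r by simp
    then show "X \<in> rcosets\<^bsub>?S\<^esub> H" using x unfolding RCOSETS_def by blast
  qed
  moreover have "inj_on C {0..<int m}"
  proof (rule inj_onI)
    fix r s assume r: "r \<in> {0..<int m}" and "s \<in> {0..<int m}" and eq: "C r = C s"
    have "(r, \<one>\<^bsub>G\<^esub>) \<in> C r" using r by (simp add: C_def)
    then have "r mod int m = s" unfolding eq by (simp add: C_def)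
    then show "r = s" using r by simp
  qed
  ultimately show "card (rcosets\<^bsub>?S\<^esub> H) = m" by (simp add: card_image)
qed

section \<open>Matrices of automorphisms, their determinants and traces\<close>

lemma exponent_sum_ab_class:
  assumes "u \<in> carrier free_group" "v \<in> carrier free_group"
    and eq: "ab_class free_group u = ab_class free_group v"
  shows "exponent_sum j u = exponent_sum j v"
proof -
  let ?D = "derived free_group (carrier free_group)"
  interpret F: group free_group by (rule group_free_group)
  interpret Z: comm_group integer_group
    by (rule group.group_comm_groupI) (auto simp: ac_simps)
  interpret e: group_hom free_group integer_group "exponent_sum j"
    by (rule group_hom_exponent_sum)
  have "u \<in> ?D #>\<^bsub>free_group\<^esub> v"
    using eq F.rcos_self[of u ?D] F.derived_is_subgroup[of "carrier free_group"] assms(1)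
    by (simp add: ab_class_def)
  then obtain d where d: "d \<in> ?D" "u = d \<otimes>\<^bsub>free_group\<^esub> v" by (auto simp: r_coset_def)
  have "exponent_sum j ` ?D = derived integer_group (exponent_sum j ` carrier free_group)"
    by (rule e.derived_img[symmetric]) simp
  also have "\<dots> = {0}" using Z.derived_eq_singleton[of "exponent_sum j ` carrier free_group"] by auto
  finally have "exponent_sum j d = 0" using d(1) by blast
  moreover have "d \<in> carrier free_group" using d(1) F.derived_in_carrier[of "carrier free_group"] by auto
  ultimately show ?thesis using d(2) assms(2) by (simp add: exponent_sum_mult)
qed

text \<open>This replaces coordinates in a quotient group by homomorphisms on words, the form
  required by \<open>free_automorphism_mod\<close>.\<close>

lemma ab_matrix_nth:
  assumes "\<phi> \<in> auto F2"
  shows "ab_matrix \<phi> $ i $ j = exponent_sum i (\<phi> (free_gen j))"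
proof -
  let ?A = "ab_matrix \<phi>"
  let ?w = "free_gen 1 [^]\<^bsub>F2\<^esub> (?A $ 1 $ j) \<otimes>\<^bsub>F2\<^esub> free_gen 2 [^]\<^bsub>F2\<^esub> (?A $ 2 $ j)"
  interpret Q: comm_group "abelianization F2" by (rule ab_class_hom(1)[OF group_free_group])
  interpret h: group_hom F2 "abelianization F2" "ab_class F2"
    using ab_class_hom(2)[OF group_free_group] group_free_group Q.is_group
    by (auto simp: group_hom_def group_hom_axioms_def)
  interpret e: group_hom F2 integer_group "exponent_sum i" by (rule group_hom_exponent_sum)
  have cl: "\<phi> (free_gen j) \<in> carrier F2" using assms by (auto simp: auto_def hom_def)
  have "ab_class F2 (\<phi> (free_gen j)) = ab_class F2 ?w"
    using is_ab_matrix_ab_matrix[OF assms] induced_ab_class[OF group_free_group assms, of "free_gen j"]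
    by (simp add: is_ab_matrix_def h.hom_int_pow)
  then have "exponent_sum i (\<phi> (free_gen j)) = exponent_sum i ?w"
    using cl by (intro exponent_sum_ab_class) simp_all
  also have "\<dots> = ?A $ i $ j"
    using exhaust_2[of i] by (auto simp: e.hom_int_pow exponent_sum_free_gen)
  finally show ?thesis by simp
qed

text \<open>Both sides are additive in \<open>u\<close> and agree on generators. This yields the
  product rule for \<open>ab_matrix\<close>.\<close>

lemma exponent_sum_hom:
  fixes h :: "('a::finite \<times> bool) list \<Rightarrow> ('b \<times> bool) list"
  assumes "h \<in> hom free_group free_group" "u \<in> carrier free_group"
  shows "exponent_sum i (h u) = (\<Sum>j\<in>UNIV. exponent_sum i (h (free_gen j)) * exponent_sum j u)"
proof -
  interpret h: group_hom free_group free_group h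
    using assms group_free_group by (simp add: group_hom_def group_hom_axioms_def group_free_group)
  show ?thesis
    using assms(2)
  proof (induction u rule: free_group_induct)
    case one
    show ?case by (simp add: exponent_sum_one)
  next
    case (gen j)
    show ?case by (simp add: exponent_sum_free_gen if_distrib[of "\<lambda>x. _ * x"] cong: if_cong)
  next
    case (inv j)
    show ?case
      by (simp add: exponent_sum_inv exponent_sum_free_gen sum_negf
          if_distrib[of "\<lambda>x. _ * x"] cong: if_cong)
  next
    case (mult u v)
    then show ?case by (simp add: exponent_sum_mult distrib_left sum.distrib)
  qed
qed

lemma ab_matrix_mult:
  assumes "\<phi> \<in> auto F2" "\<theta> \<in> auto F2"
  shows "ab_matrix (\<phi> \<otimes>\<^bsub>AutoGroup F2\<^esub> \<theta>) = ab_matrix \<phi> ** ab_matrix \<theta>"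
proof -
  interpret A: group "AutoGroup F2" by (rule group.AutoGroup[OF group_free_group])
  have "\<phi> \<otimes>\<^bsub>AutoGroup F2\<^esub> \<theta> \<in> auto F2"
    using assms A.m_closed by (simp add: carrier_AutoGroup)
  moreover have "\<phi> \<in> hom F2 F2" "\<theta> (free_gen j) \<in> carrier F2" for j
    using assms by (auto simp: auto_def hom_def)
  ultimately show ?thesis
    using assms exponent_sum_hom[of \<phi>]
    by (simp add: vec_eq_iff matrix_matrix_mult_def ab_matrix_nth AutoGroup_mult_apply)
qed

text \<open>The inverse automorphism has an inverse matrix over the integers, so the determinant is
  a unit.\<close>

lemma det_ab_matrix:
  assumes "\<phi> \<in> auto F2"
  shows "det (ab_matrix \<phi>) = 1 \<or> det (ab_matrix \<phi>) = -1"
proof -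
  interpret A: group "AutoGroup F2" by (rule group.AutoGroup[OF group_free_group])
  have inv: "inv\<^bsub>AutoGroup F2\<^esub> \<phi> \<in> auto F2"
    using assms A.inv_closed by (simp add: carrier_AutoGroup)
  have one: "\<one>\<^bsub>AutoGroup F2\<^esub> \<in> auto F2" using A.one_closed by (simp add: carrier_AutoGroup)
  have "ab_matrix \<one>\<^bsub>AutoGroup F2\<^esub> = mat 1"
    by (simp add: vec_eq_iff mat_def ab_matrix_nth[OF one] AutoGroup_one_apply
        exponent_sum_free_gen eq_commute)
  then have "ab_matrix (inv\<^bsub>AutoGroup F2\<^esub> \<phi>) ** ab_matrix \<phi> = mat 1"
    using assms by (simp add: ab_matrix_mult[OF inv assms, symmetric] carrier_AutoGroup)
  then have "det (ab_matrix (inv\<^bsub>AutoGroup F2\<^esub> \<phi>)) * det (ab_matrix \<phi>) = 1"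
    by (metis det_I det_mul)
  then show ?thesis by (auto simp: zmult_eq_1_iff)
qed

lemma trace_mult_self_2:
  fixes A :: "'a::comm_ring_1^2^2"
  shows "trace (A ** A) = (trace A)\<^sup>2 - 2 * det A"
  by (simp add: trace_def det_2 matrix_matrix_mult_def sum_2 power2_eq_square algebra_simps)

text \<open>By Cayley--Hamilton, \<open>(B - 1)\<^sup>2 = (trace B - 2) B\<close> if \<open>det B = 1\<close>.\<close>

lemma dvd_square_of_trace:
  fixes B :: "int^2^2"
  assumes "det B = 1" "p dvd trace B - 2"
  shows "p dvd (\<Sum>i\<in>UNIV. (B $ k $ i - (if i = k then 1 else 0)) * (B $ i $ j - (if j = i then 1 else 0)))"
proof -
  have "B $ 1 $ 1 * B $ 2 $ 2 - B $ 1 $ 2 * B $ 2 $ 1 = 1" using assms(1) by (simp add: det_2)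
  then have "(\<Sum>i\<in>UNIV. (B $ k $ i - (if i = k then 1 else 0)) * (B $ i $ j - (if j = i then 1 else 0)))
      = (trace B - 2) * B $ k $ j"
    using exhaust_2[of k] exhaust_2[of j] by (auto simp: trace_def sum_2 algebra_simps)
  then show ?thesis using assms(2) by simp
qed

text \<open>By \<open>dvd_square_of_trace\<close> the power of \<phi> satisfies
  \<open>square\<close>; the result for its semidirect product is carried over to the
  subgroup.\<close>

lemma residually_nilpotent_subgroup_of_index:
  assumes phi: "\<phi> \<in> auto F2" and m: "m > 0" and p: "prime p"
    and det: "det (ab_matrix (\<phi> [^]\<^bsub>AutoGroup F2\<^esub> m)) = 1"
    and tr: "p dvd trace (ab_matrix (\<phi> [^]\<^bsub>AutoGroup F2\<^esub> m)) - 2"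
  shows "\<exists>H. subgroup H (semidirect_int F2 \<phi>) \<and> card (rcosets\<^bsub>semidirect_int F2 \<phi>\<^esub> H) = m \<and>
    residually_nilpotent ((semidirect_int F2 \<phi>)\<lparr>carrier := H\<rparr>) \<and>
    (semidirect_int F2 \<phi>)\<lparr>carrier := H\<rparr> \<cong> semidirect_int F2 (\<phi> [^]\<^bsub>AutoGroup F2\<^esub> m)"
proof -
  let ?S = "semidirect_int F2 \<phi>" and ?\<psi> = "\<phi> [^]\<^bsub>AutoGroup F2\<^esub> m"
  let ?H = "{(k, u). int m dvd k \<and> u \<in> carrier F2}"
  interpret A: group "AutoGroup F2" by (rule group.AutoGroup[OF group_free_group])
  have psi: "?\<psi> \<in> auto F2" using A.nat_pow_closed[of \<phi> m] phi by (simp add: carrier_AutoGroup)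
  interpret free_automorphism_mod ?\<psi> p
    using psi dvd_square_of_trace[OF det tr]
    by (intro free_automorphism_mod.intro automorphism_mod.intro automorphism_mod_axioms.intro
        free_automorphism_mod_axioms.intro group_free_group) (simp_all add: ab_matrix_nth)
  note H = semidirect_int_pow_subgroup[OF group_free_group phi m]
  interpret P: group ?S by (rule group_semidirect_int[OF group_free_group phi])
  have grp: "group (?S\<lparr>carrier := ?H\<rparr>)" by (rule P.subgroup_imp_group[OF H(1)])
  have "residually_nilpotent (?S\<lparr>carrier := ?H\<rparr>)"
    by (rule residually_nilpotent_iso[OF S.group_axioms grp H(3) lower_central_trivial_Inter[OF p]])
  moreover have "?S\<lparr>carrier := ?H\<rparr> \<cong> semidirect_int F2 ?\<psi>"
    using group.iso_sym[OF group_semidirect_int[OF group_free_group psi]] H(3) by (auto simp: is_iso_def)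
  ultimately show ?thesis using H(1,2) by blast
qed

text \<open>For trace \<open>t\<close> and determinant \<open>d\<close> of a matrix, the number is
  the trace of its square minus \<open>2\<close>. It is \<open>t^2 - 4\<close> or
  \<open>t^2\<close>, and is a unit only in the excluded case; if it is zero, any prime will
  do.\<close>

lemma exists_prime_dvd_trace:
  fixes t d :: int
  assumes "d = 1 \<or> d = -1" "\<not> (d = -1 \<and> (t = 1 \<or> t = -1))"
  shows "\<exists>p. prime p \<and> p dvd t\<^sup>2 - 2 * d - 2"
proof (cases "t\<^sup>2 - 2 * d - 2 = 0")
  case True
  then show ?thesis using two_is_prime_nat by (intro exI[of _ 2]) simp
next
  case False
  have "t\<^sup>2 \<noteq> 3 \<and> t\<^sup>2 \<noteq> 5"
  proof (cases "\<bar>t\<bar> \<le> 2")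
    case True
    then have "t \<in> {-2, -1, 0, 1, 2}" by auto
    then show ?thesis by auto
  next
    case False
    then have "3\<^sup>2 \<le> \<bar>t\<bar>\<^sup>2" by (intro power_mono) auto
    then show ?thesis by simp
  qed
  moreover have "t\<^sup>2 \<noteq> 1" if "d = -1" using assms(2) that by (simp add: power2_eq_1_iff)
  moreover have "t\<^sup>2 \<noteq> -1" using zero_le_power2[of t] by linarith
  ultimately have "\<not> t\<^sup>2 - 2 * d - 2 dvd 1" using assms(1) by auto
  then show ?thesis using prime_divisor_exists[OF False] by blast
qed

theorem lemma7p9:
  fixes \<phi> :: "(2 \<times> bool) list \<Rightarrow> (2 \<times> bool) list"
    and G :: "(int \<times> (2 \<times> bool) list) monoid"
  assumes "\<phi> \<in> auto F2"
    and "G = semidirect_int F2 \<phi>"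
  shows "(\<not> (det (ab_matrix \<phi>) = -1 \<and> (trace (ab_matrix \<phi>) = 1 \<or> trace (ab_matrix \<phi>) = -1)) \<longrightarrow>
           (\<exists>H. subgroup H G \<and> card (rcosets\<^bsub>G\<^esub> H) = 2 \<and>
              residually_nilpotent (G\<lparr>carrier := H\<rparr>) \<and>
              G\<lparr>carrier := H\<rparr> \<cong> semidirect_int F2 (\<phi> [^]\<^bsub>AutoGroup F2\<^esub> (2::nat)))) \<and>
         (det (ab_matrix \<phi>) = -1 \<and> (trace (ab_matrix \<phi>) = 1 \<or> trace (ab_matrix \<phi>) = -1) \<longrightarrow>
           (\<exists>H. subgroup H G \<and> card (rcosets\<^bsub>G\<^esub> H) = 4 \<and>
              residually_nilpotent (G\<lparr>carrier := H\<rparr>) \<and>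
              G\<lparr>carrier := H\<rparr> \<cong> semidirect_int F2 (\<phi> [^]\<^bsub>AutoGroup F2\<^esub> (4::nat))))"
proof (intro conjI impI; unfold assms(2))
  interpret A: group "AutoGroup F2" by (rule group.AutoGroup[OF group_free_group])
  let ?A = "ab_matrix \<phi>" and ?\<phi>2 = "\<phi> [^]\<^bsub>AutoGroup F2\<^esub> (2::nat)"
  have phi: "\<phi> \<in> carrier (AutoGroup F2)" using assms(1) by (simp add: carrier_AutoGroup)
  have phi2: "?\<phi>2 \<in> auto F2" using A.nat_pow_closed[OF phi] by (simp add: carrier_AutoGroup)
  have "?\<phi>2 = \<phi> \<otimes>\<^bsub>AutoGroup F2\<^esub> \<phi>" using phi by (simp add: numeral_2_eq_2)
  then have M2: "ab_matrix ?\<phi>2 = ?A ** ?A" by (simp add: ab_matrix_mult assms(1))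
  have det2: "det (ab_matrix ?\<phi>2) = 1" using det_ab_matrix[OF assms(1)] by (auto simp: M2 det_mul)
  have tr2: "trace (ab_matrix ?\<phi>2) = (trace ?A)\<^sup>2 - 2 * det ?A" by (simp add: M2 trace_mult_self_2)
  let ?e = "det ?A = -1 \<and> (trace ?A = 1 \<or> trace ?A = -1)"
  show "\<exists>H. subgroup H (semidirect_int F2 \<phi>) \<and> card (rcosets\<^bsub>semidirect_int F2 \<phi>\<^esub> H) = 2 \<and>
      residually_nilpotent ((semidirect_int F2 \<phi>)\<lparr>carrier := H\<rparr>) \<and>
      (semidirect_int F2 \<phi>)\<lparr>carrier := H\<rparr> \<cong> semidirect_int F2 ?\<phi>2" if ne: "\<not> ?e"
  proof -
    obtain p where "prime p" "p dvd (trace ?A)\<^sup>2 - 2 * det ?A - 2"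
      using exists_prime_dvd_trace[OF det_ab_matrix[OF assms(1)] ne] by blast
    then show ?thesis
      using det2 by (intro residually_nilpotent_subgroup_of_index assms(1)) (simp_all add: tr2)
  qed
  show "\<exists>H. subgroup H (semidirect_int F2 \<phi>) \<and> card (rcosets\<^bsub>semidirect_int F2 \<phi>\<^esub> H) = 4 \<and>
      residually_nilpotent ((semidirect_int F2 \<phi>)\<lparr>carrier := H\<rparr>) \<and>
      (semidirect_int F2 \<phi>)\<lparr>carrier := H\<rparr> \<cong> semidirect_int F2 (\<phi> [^]\<^bsub>AutoGroup F2\<^esub> (4::nat))" if e: ?e
  proof -
    have "\<phi> [^]\<^bsub>AutoGroup F2\<^esub> (4::nat) = ?\<phi>2 \<otimes>\<^bsub>AutoGroup F2\<^esub> ?\<phi>2"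
      using phi by (simp add: A.nat_pow_mult)
    then have M4: "ab_matrix (\<phi> [^]\<^bsub>AutoGroup F2\<^esub> (4::nat)) = ab_matrix ?\<phi>2 ** ab_matrix ?\<phi>2"
      by (simp add: ab_matrix_mult phi2)
    \<comment> \<open>Here the square of \<open>?A\<close> has trace \<open>3\<close>, and
      \<open>3 - 2 = 1\<close> has no prime divisor. The fourth power has trace
      \<open>9 - 2 = 7\<close>, and \<open>7 - 2 = 5\<close> supplies the prime.\<close>
    have "(trace ?A)\<^sup>2 = 1" using e by auto
    then have "trace (ab_matrix (\<phi> [^]\<^bsub>AutoGroup F2\<^esub> (4::nat))) = 7"
      using e by (simp add: M4 trace_mult_self_2 det2 tr2)
    moreover have "prime (5::int)" by simp
    ultimately show ?thesis
      using det2 by (intro residually_nilpotent_subgroup_of_index[where p = 5] assms(1))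
        (simp_all add: M4 det_mul)
  qed
qed

end
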